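(* A graph $G$ is a polar-cat if and only if $G$ is primitive and $G$ can be explained by a labeled level-1 network.
   Context: All graphs finite, simple, undirected; $G-v$, complement, join, cograph (no induced $P_4$) as usual. Module of $G=(V,E)$: $M\subseteq V$ with $N_G(x)\setminus M=N_G(y)\setminus M$ for all $x,y\in M$; $G$ is primitive if $|V|\ge4$ and its only modules are $V$ and singletons (and $\emptyset$). Network on finite $X$: a DAG $N=(V,E)$ with either $V=X=\{x\}$, or (N1) unique root of indegree 0, outdegree $\ge2$; (N2) $x\in X$ iff outdegree 0, indegree 1; (N3) every other non-root vertex has indegree 1 and outdegree $\ge2$, or indegree 2 (hybrid-vertex) and outdegree $\ge1$. Level-1: every biconnected component of the underlying undirected graph contains at most one hybrid-vertex (then lowest common ancestors $\mathrm{lca}_N(x,y)$ of leaves are unique). A labeled network $(N,t)$ has $t:V\to\{0,1,\odot\}$, $t(v)=\odot$ iff $v\in X$; it explains $G$ if $G$ is isomorphic to the graph on $X$ where $x\ne y$ are adjacent iff $t(\mathrm{lca}_N(x,y))=1$. Polar-cats: $G$ is a $(v,G_1,G_2)$-pseudo-cograph if $G_1,G_2$ are induced subgraphs, $v\in V(G)$, with $V(G)=V(G_1)\cup V(G_2)$, $V(G_1)\cap V(G_2)=\{v\}$, $|V(G_1)|,|V(G_2)|>1$, $G_1,G_2$ cographs, and $G-v$ the join or disjoint union of $G_1-v$ and $G_2-v$. A caterpillar is a rooted tree whose inner vertices each have two children and induce a path with the root at one end; a cherry is a pair of leaves with a common parent. A cograph is caterpillar-explainable if its unique discriminating cotree (labeled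 tree explaining it with adjacent inner vertices differently labeled) is a caterpillar. A $(v,G_1,G_2)$-pseudo-cograph $G$ with $|V(G)|\ge4$ is a $(v,G_1,G_2)$-polar-cat if either ($G_1,G_2$ both connected and $G-v$ the disjoint union of $G_1-v,G_2-v$) or ($G_1,G_2$ both disconnected and $G-v$ the join), and $G_1,G_2$ are caterpillar-explainable with $v$ part of a cherry in both explaining caterpillars. A polar-cat is a $(v,G_1,G_2)$-polar-cat for some $v,G_1,G_2$. *)

theory Defs
  imports Main
begin

section \<open>Simple graphs\<close>

record 'a graph =
  gV :: "'a set"
  gE :: "('a \<times> 'a) set"

definition is_graph :: "'a graph \<Rightarrow> bool" where
  "is_graph G \<longleftrightarrow> finite (gV G) \<and> gE G \<subseteq> gV G \<times> gV G \<and> sym (gE G) \<and> irrefl (gE G)"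

definition nbhd :: "'a graph \<Rightarrow> 'a \<Rightarrow> 'a set" where
  "nbhd G x = {y. (x, y) \<in> gE G}"

definition induced :: "'a graph \<Rightarrow> 'a set \<Rightarrow> 'a graph" where
  "induced G W = \<lparr>gV = W, gE = gE G \<inter> (W \<times> W)\<rparr>"

definition delete :: "'a graph \<Rightarrow> 'a \<Rightarrow> 'a graph" where
  "delete G v = induced G (gV G - {v})"

definition is_module :: "'a graph \<Rightarrow> 'a set \<Rightarrow> bool" where
  "is_module G M \<longleftrightarrow> M \<subseteq> gV G \<and> (\<forall>x\<in>M. \<forall>y\<in>M. nbhd G x - M = nbhd G y - M)"

definition primitive :: "'a graph \<Rightarrow> bool" where
  "primitive G \<longleftrightarrow> card (gV G) \<ge> 4 \<and>
     (\<forall>M. is_module G M \<longrightarrow> M = {} \<or> M = gV G \<or> (\<exists>x. M = {x}))"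

text \<open>Cograph: no induced path on four vertices a-b-c-d.\<close>
definition is_cograph :: "'a graph \<Rightarrow> bool" where
  "is_cograph G \<longleftrightarrow> \<not> (\<exists>a b c d. distinct [a, b, c, d] \<and> {a, b, c, d} \<subseteq> gV G \<and>
      (a, b) \<in> gE G \<and> (b, c) \<in> gE G \<and> (c, d) \<in> gE G \<and>
      (a, c) \<notin> gE G \<and> (b, d) \<notin> gE G \<and> (a, d) \<notin> gE G)"

definition connected_graph :: "'a graph \<Rightarrow> bool" where
  "connected_graph G \<longleftrightarrow> gV G \<noteq> {} \<and> (\<forall>x\<in>gV G. \<forall>y\<in>gV G. (x, y) \<in> (gE G)\<^sup>*)"

definition disjoint_union_of :: "'a graph \<Rightarrow> 'a graph \<Rightarrow> 'a graph \<Rightarrow> bool" where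
  "disjoint_union_of H H1 H2 \<longleftrightarrow> gV H = gV H1 \<union> gV H2 \<and> gV H1 \<inter> gV H2 = {} \<and>
     gE H = gE H1 \<union> gE H2"

definition join_of :: "'a graph \<Rightarrow> 'a graph \<Rightarrow> 'a graph \<Rightarrow> bool" where
  "join_of H H1 H2 \<longleftrightarrow> gV H = gV H1 \<union> gV H2 \<and> gV H1 \<inter> gV H2 = {} \<and>
     gE H = gE H1 \<union> gE H2 \<union> (gV H1 \<times> gV H2) \<union> (gV H2 \<times> gV H1)"

section \<open>Networks\<close>

datatype label = Lab0 | Lab1 | LabOdot

definition indeg :: "('v \<times> 'v) set \<Rightarrow> 'v \<Rightarrow> nat" where
  "indeg E w = card {u. (u, w) \<in> E}"

definition outdeg :: "('v \<times> 'v) set \<Rightarrow> 'v \<Rightarrow> nat" where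
  "outdeg E u = card {w. (u, w) \<in> E}"

text \<open>A network (V,E) on leaf set X.\<close>
definition is_network :: "'v set \<Rightarrow> ('v \<times> 'v) set \<Rightarrow> 'v set \<Rightarrow> bool" where
  "is_network V E X \<longleftrightarrow> finite V \<and> E \<subseteq> V \<times> V \<and> acyclic E \<and> X \<subseteq> V \<and>
    ((\<exists>x. V = {x} \<and> X = {x}) \<or>
     ((\<exists>\<rho>\<in>V. indeg E \<rho> = 0 \<and> outdeg E \<rho> \<ge> 2 \<and> (\<forall>u\<in>V. indeg E u = 0 \<longrightarrow> u = \<rho>)) \<and>
      (\<forall>x\<in>V. x \<in> X \<longleftrightarrow> outdeg E x = 0 \<and> indeg E x = 1) \<and>
      (\<forall>u\<in>V. indeg E u \<noteq> 0 \<longrightarrow> u \<notin> X \<longrightarrow>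
          (indeg E u = 1 \<and> outdeg E u \<ge> 2) \<or> (indeg E u = 2 \<and> outdeg E u \<ge> 1))))"

definition hybrid :: "('v \<times> 'v) set \<Rightarrow> 'v \<Rightarrow> bool" where
  "hybrid E u \<longleftrightarrow> indeg E u = 2"

text \<open>Connectivity of the subgraph of the underlying undirected graph induced by W.\<close>
definition uconnected_on :: "('v \<times> 'v) set \<Rightarrow> 'v set \<Rightarrow> bool" where
  "uconnected_on E W \<longleftrightarrow> W \<noteq> {} \<and>
     (\<forall>x\<in>W. \<forall>y\<in>W. (x, y) \<in> ((E \<union> E\<inverse>) \<inter> (W \<times> W))\<^sup>*)"

definition biconnected_on :: "('v \<times> 'v) set \<Rightarrow> 'v set \<Rightarrow> bool" where
  "biconnected_on E W \<longleftrightarrow> card W \<ge> 2 \<and> uconnected_on E W \<and>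
     (\<forall>w\<in>W. uconnected_on E (W - {w}))"

definition biconnected_component :: "'v set \<Rightarrow> ('v \<times> 'v) set \<Rightarrow> 'v set \<Rightarrow> bool" where
  "biconnected_component V E W \<longleftrightarrow> W \<subseteq> V \<and> biconnected_on E W \<and>
     (\<forall>W'. W \<subseteq> W' \<longrightarrow> W' \<subseteq> V \<longrightarrow> biconnected_on E W' \<longrightarrow> W' = W)"

definition level1_network :: "'v set \<Rightarrow> ('v \<times> 'v) set \<Rightarrow> 'v set \<Rightarrow> bool" where
  "level1_network V E X \<longleftrightarrow> is_network V E X \<and>
     (\<forall>W. biconnected_component V E W \<longrightarrow> card {u\<in>W. hybrid E u} \<le> 1)"

definition is_lca :: "('v \<times> 'v) set \<Rightarrow> 'v \<Rightarrow> 'v \<Rightarrow> 'v \<Rightarrow> bool" where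
  "is_lca E x y u \<longleftrightarrow> (u, x) \<in> E\<^sup>* \<and> (u, y) \<in> E\<^sup>* \<and>
     (\<forall>u'. (u', x) \<in> E\<^sup>* \<longrightarrow> (u', y) \<in> E\<^sup>* \<longrightarrow> (u, u') \<in> E\<^sup>* \<longrightarrow> u' = u)"

definition lca :: "('v \<times> 'v) set \<Rightarrow> 'v \<Rightarrow> 'v \<Rightarrow> 'v" where
  "lca E x y = (THE u. is_lca E x y u)"

definition labeled_network :: "'v set \<Rightarrow> ('v \<times> 'v) set \<Rightarrow> 'v set \<Rightarrow> ('v \<Rightarrow> label) \<Rightarrow> bool" where
  "labeled_network V E X t \<longleftrightarrow> is_network V E X \<and> (\<forall>v\<in>V. t v = LabOdot \<longleftrightarrow> v \<in> X)"

text \<open>(N,t) explains G: G is isomorphic (via phi) to the graph on X given by lca labels.\<close>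
definition explains_via ::
  "('v \<times> 'v) set \<Rightarrow> 'v set \<Rightarrow> ('v \<Rightarrow> label) \<Rightarrow> ('v \<Rightarrow> 'a) \<Rightarrow> 'a graph \<Rightarrow> bool" where
  "explains_via E X t \<phi> G \<longleftrightarrow> bij_betw \<phi> X (gV G) \<and>
     (\<forall>x\<in>X. \<forall>y\<in>X. x \<noteq> y \<longrightarrow> ((\<phi> x, \<phi> y) \<in> gE G \<longleftrightarrow> t (lca E x y) = Lab1))"

text \<open>Network vertices are taken from the (infinite) type 'a + nat; every finite network
  is isomorphic to one of this type, so no generality is lost.\<close>
definition level1_explainable :: "'a graph \<Rightarrow> bool" where
  "level1_explainable G \<longleftrightarrow> (\<exists>(V :: ('a + nat) set) E X t \<phi>.
     level1_network V E X \<and> labeled_network V E X t \<and> explains_via E X t \<phi> G)"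

section \<open>Cotrees and caterpillars\<close>

definition is_tree :: "'v set \<Rightarrow> ('v \<times> 'v) set \<Rightarrow> 'v set \<Rightarrow> bool" where
  "is_tree V E X \<longleftrightarrow> is_network V E X \<and> (\<forall>u\<in>V. indeg E u \<le> 1)"

text \<open>A cotree of G: labeled tree whose leaves are (copies Inl x of) the vertices of G.\<close>
definition cotree_of :: "'a graph \<Rightarrow> ('a + nat) set \<Rightarrow> (('a + nat) \<times> ('a + nat)) set \<Rightarrow>
    (('a + nat) \<Rightarrow> label) \<Rightarrow> bool" where
  "cotree_of G V E t \<longleftrightarrow> is_tree V E (Inl ` gV G) \<and> labeled_network V E (Inl ` gV G) t \<and>
     (\<forall>x\<in>gV G. \<forall>y\<in>gV G. x \<noteq> y \<longrightarrow> ((x, y) \<in> gE G \<longleftrightarrow> t (lca E (Inl x) (Inl y)) = Lab1))"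

definition discriminating :: "('v \<times> 'v) set \<Rightarrow> 'v set \<Rightarrow> ('v \<Rightarrow> label) \<Rightarrow> bool" where
  "discriminating E X t \<longleftrightarrow> (\<forall>(u, w)\<in>E. u \<notin> X \<longrightarrow> w \<notin> X \<longrightarrow> t u \<noteq> t w)"

text \<open>Caterpillar: every inner vertex has two children and the inner vertices induce a
  path starting at the root.\<close>
definition caterpillar :: "'v set \<Rightarrow> ('v \<times> 'v) set \<Rightarrow> 'v set \<Rightarrow> bool" where
  "caterpillar V E X \<longleftrightarrow> is_tree V E X \<and> (\<forall>u\<in>V - X. outdeg E u = 2) \<and>
     (\<exists>ps. ps \<noteq> [] \<and> distinct ps \<and> set ps = V - X \<and> indeg E (hd ps) = 0 \<and>
        E \<inter> ((V - X) \<times> (V - X)) = set (zip ps (tl ps)))"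

definition in_cherry :: "('v \<times> 'v) set \<Rightarrow> 'v set \<Rightarrow> 'v \<Rightarrow> bool" where
  "in_cherry E X l \<longleftrightarrow> l \<in> X \<and> (\<exists>l'\<in>X. l' \<noteq> l \<and> (\<exists>p. (p, l) \<in> E \<and> (p, l') \<in> E))"

text \<open>G is caterpillar-explainable (its discriminating cotree is a caterpillar) and v is
  part of a cherry in that caterpillar.\<close>
definition cat_explainable_cherry :: "'a graph \<Rightarrow> 'a \<Rightarrow> bool" where
  "cat_explainable_cherry G v \<longleftrightarrow> (\<exists>V E t. cotree_of G V E t \<and>
     discriminating E (Inl ` gV G) t \<and> caterpillar V E (Inl ` gV G) \<and>
     in_cherry E (Inl ` gV G) (Inl v))"

section \<open>Pseudo-cographs and polar-cats\<close>

definition pseudo_cograph :: "'a graph \<Rightarrow> 'a \<Rightarrow> 'a set \<Rightarrow> 'a set \<Rightarrow> bool" where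
  "pseudo_cograph G v V1 V2 \<longleftrightarrow> v \<in> gV G \<and> V1 \<subseteq> gV G \<and> V2 \<subseteq> gV G \<and>
     gV G = V1 \<union> V2 \<and> V1 \<inter> V2 = {v} \<and> card V1 > 1 \<and> card V2 > 1 \<and>
     is_cograph (induced G V1) \<and> is_cograph (induced G V2) \<and>
     (join_of (delete G v) (delete (induced G V1) v) (delete (induced G V2) v) \<or>
      disjoint_union_of (delete G v) (delete (induced G V1) v) (delete (induced G V2) v))"

definition polar_cat_at :: "'a graph \<Rightarrow> 'a \<Rightarrow> 'a set \<Rightarrow> 'a set \<Rightarrow> bool" where
  "polar_cat_at G v V1 V2 \<longleftrightarrow> pseudo_cograph G v V1 V2 \<and> card (gV G) \<ge> 4 \<and>
     ((connected_graph (induced G V1) \<and> connected_graph (induced G V2) \<and>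
       disjoint_union_of (delete G v) (delete (induced G V1) v) (delete (induced G V2) v)) \<or>
      (\<not> connected_graph (induced G V1) \<and> \<not> connected_graph (induced G V2) \<and>
       join_of (delete G v) (delete (induced G V1) v) (delete (induced G V2) v))) \<and>
     cat_explainable_cherry (induced G V1) v \<and> cat_explainable_cherry (induced G V2) v"

definition polar_cat :: "'a graph \<Rightarrow> bool" where
  "polar_cat G \<longleftrightarrow> (\<exists>v V1 V2. polar_cat_at G v V1 V2)"

end

theory Submission
  imports Defs
begin

text \<open>
  Both sides are compared with a normal form: a vertex \<open>v\<close> and two lists \<open>xs\<close>, \<open>ys\<close> (the leaves of
  the two caterpillars from the root down to the cherry containing \<open>v\<close>) such that every vertex is
  adjacent, alternately, to all or to none of the later vertices of its list and \<open>v\<close>, and all or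
  none of the edges between \<open>xs\<close> and \<open>ys\<close> are present.

  A graph in normal form is primitive, because a module with two elements absorbs \<open>v\<close> and then
  everything; it is explained by a cycle that consists of a root, the two spines and one
  hybrid-vertex above \<open>v\<close>.

  Conversely, a part of a network that can be entered only from a single vertex contributes a module,
  so in a network explaining a primitive graph it has at most one leaf or all of them. If no two
  children of the root had a common descendant, this would leave at most two leaves. Hence the root
  lies on a cycle with one hybrid-vertex \<open>h\<close>. By the level-1 condition, what hangs off different
  vertices of the cycle is disjoint, since two such parts meeting would add an ear with a second
  hybrid-vertex to the block. So every non-root vertex of the cycle carries
  exactly one leaf and the root none. Equal consecutive labels would yield a module consisting of two
  leaves, and a first label equal to that of the root a module missing one leaf; so the labels
  alternate.
\<close>

section \<open>The normal form\<close>

text \<open>A vertex ordering read off a caterpillar from the root downwards: \<open>zs ! i\<close> hangs at the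
  \<open>i\<close>-th inner vertex, whose label \<open>f i\<close> decides the adjacency of \<open>zs ! i\<close> to everything below.\<close>
definition staged :: "('a \<times> 'a) set \<Rightarrow> (nat \<Rightarrow> bool) \<Rightarrow> 'a list \<Rightarrow> bool" where
  "staged R f zs \<longleftrightarrow> (\<forall>i j. i < j \<longrightarrow> j < length zs \<longrightarrow> ((zs ! i, zs ! j) \<in> R \<longleftrightarrow> f i))"

text \<open>The two caterpillars of a polar-cat with their common cherry leaf \<open>v\<close>. Discriminating labels
  alternate along the spine, and \<open>b\<close> says whether both root labels are 1, that is, whether
  \<open>G\<^sub>1\<close> and \<open>G\<^sub>2\<close> are connected.\<close>
definition polar_lists :: "'a graph \<Rightarrow> bool \<Rightarrow> 'a \<Rightarrow> 'a list \<Rightarrow> 'a list \<Rightarrow> bool" where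
  "polar_lists G b v xs ys \<longleftrightarrow> xs \<noteq> [] \<and> ys \<noteq> [] \<and> length xs + length ys \<ge> 3 \<and>
     distinct (v # xs @ ys) \<and> gV G = set (v # xs @ ys) \<and>
     staged (gE G) (\<lambda>i. even i = b) (xs @ [v]) \<and> staged (gE G) (\<lambda>i. even i = b) (ys @ [v]) \<and>
     (\<forall>x\<in>set xs. \<forall>y\<in>set ys. (x, y) \<in> gE G \<longleftrightarrow> \<not> b)"

lemma stagedD: "staged R f zs \<Longrightarrow> i < j \<Longrightarrow> j < length zs \<Longrightarrow> (zs ! i, zs ! j) \<in> R \<longleftrightarrow> f i"
  by (simp add: staged_def)

lemma staged_snocD:
  assumes "staged R f (xs @ [v])"
  shows "i < j \<Longrightarrow> j < length xs \<Longrightarrow> (xs ! i, xs ! j) \<in> R \<longleftrightarrow> f i"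
    and "i < length xs \<Longrightarrow> (xs ! i, v) \<in> R \<longleftrightarrow> f i"
  using stagedD[OF assms, of i j] stagedD[OF assms, of i "length xs"]
  by (auto simp: nth_append)

lemma staged_first:
  assumes "staged R f (xs @ [v])" "xs \<noteq> []" "x \<in> set (xs @ [v])" "x \<noteq> xs ! 0"
  shows "(xs ! 0, x) \<in> R \<longleftrightarrow> f 0"
proof -
  obtain j where j: "j < length (xs @ [v])" "x = (xs @ [v]) ! j" using assms(3) by (auto simp only: in_set_conv_nth)
  then have "0 < j" using assms(2,4) by (cases j) (auto simp: nth_append)
  then show ?thesis using stagedD[OF assms(1), of 0 j] j assms(2) by (auto simp: nth_append)
qed

section \<open>Primitivity of graphs in normal form\<close>

lemma is_graph_sym: "is_graph G \<Longrightarrow> (x, y) \<in> gE G \<longleftrightarrow> (y, x) \<in> gE G"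
  by (auto simp: is_graph_def sym_def)

text \<open>This is the definition of a module turned into a closure rule. The three lemmas below
  start from two members and keep adding vertices that tell two members apart, until the whole graph
  is reached.\<close>

lemma module_absorbs:
  assumes "is_module G M" "is_graph G" "p \<in> M" "q \<in> M" "(z, p) \<in> gE G \<longleftrightarrow> (z, q) \<notin> gE G"
  shows "z \<in> M"
proof (rule ccontr)
  assume "z \<notin> M"
  moreover have "nbhd G p - M = nbhd G q - M" using assms(1,3,4) unfolding is_module_def by blast
  ultimately have "(p, z) \<in> gE G \<longleftrightarrow> (q, z) \<in> gE G" by (auto simp: nbhd_def set_eq_iff)
  with assms show False by (simp add: is_graph_sym)
qed

lemma polar_lists_swap:
  assumes "is_graph G" "polar_lists G b v xs ys" shows "polar_lists G b v ys xs"
proof -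
  have "\<forall>y\<in>set ys. \<forall>x\<in>set xs. (y, x) \<in> gE G \<longleftrightarrow> \<not> b"
    using assms is_graph_sym[OF assms(1)] unfolding polar_lists_def by metis
  then show ?thesis using assms(2) unfolding polar_lists_def by auto
qed

text \<open>The first vertices of the lists tell the others apart: \<open>ys ! 0\<close> meets
  \<open>v\<close> with value \<open>b\<close> and \<open>xs ! i\<close> with value
  \<open>\<not> b\<close>, and then \<open>xs ! 0\<close> separates \<open>v\<close> from
  \<open>ys ! 0\<close>. Once both are members, every remaining list element sees the one on its own
  side with value \<open>b\<close> and the one on the other side with value
  \<open>\<not> b\<close>.\<close>

lemma polar_lists_module_center:
  assumes G: "is_graph G" and P: "polar_lists G b v xs ys" and M: "is_module G M"
    and "v \<in> M" "i < length xs" "xs ! i \<in> M"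
  shows "M = gV G"
proof -
  note abs = module_absorbs[OF M G]
  have sx: "staged (gE G) (\<lambda>i. even i = b) (xs @ [v])" and sy: "staged (gE G) (\<lambda>i. even i = b) (ys @ [v])"
    and cr: "\<And>x y. x \<in> set xs \<Longrightarrow> y \<in> set ys \<Longrightarrow> (x, y) \<in> gE G \<longleftrightarrow> \<not> b"
    and ne: "xs \<noteq> []" "ys \<noteq> []" and V: "gV G = set (v # xs @ ys)"
    using P by (auto simp: polar_lists_def)
  note X = staged_snocD[OF sx] and Y = staged_snocD[OF sy]
  have x0: "xs ! 0 \<in> set xs" and y0: "ys ! 0 \<in> set ys" using ne by (simp_all)
  have y0M: "ys ! 0 \<in> M"
  proof (rule abs[OF \<open>v \<in> M\<close> \<open>xs ! i \<in> M\<close>])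
    show "(ys ! 0, v) \<in> gE G \<longleftrightarrow> (ys ! 0, xs ! i) \<notin> gE G"
      using Y(2)[of 0] ne cr[of "xs ! i" "ys ! 0"] y0 assms(5) is_graph_sym[OF G] by auto
  qed
  have x0M: "xs ! 0 \<in> M"
  proof (rule abs[OF \<open>v \<in> M\<close> y0M])
    show "(xs ! 0, v) \<in> gE G \<longleftrightarrow> (xs ! 0, ys ! 0) \<notin> gE G"
      using X(2)[of 0] ne cr[OF x0 y0] by auto
  qed
  have "xs ! j \<in> M" if "j < length xs" for j
  proof (cases "j = 0")
    case False
    show ?thesis
      by (rule abs[OF x0M y0M])
        (use X(1)[of 0 j] that False cr[of "xs ! j" "ys ! 0"] y0 is_graph_sym[OF G] in auto)
  qed (use x0M in simp)
  moreover have "ys ! j \<in> M" if "j < length ys" for j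
  proof (cases "j = 0")
    case False
    show ?thesis
      by (rule abs[OF y0M x0M])
        (use Y(1)[of 0 j] that False cr[of "xs ! 0" "ys ! j"] x0 is_graph_sym[OF G] in auto)
  qed (use y0M in simp)
  ultimately have "gV G \<subseteq> M" using V \<open>v \<in> M\<close> by (auto simp: in_set_conv_nth)
  with M show ?thesis by (auto simp: is_module_def)
qed

text \<open>By alternation \<open>xs ! Suc i\<close> separates \<open>xs ! i\<close> from any later
  \<open>xs ! j\<close>, so the two members may be taken to be consecutive. Consecutive levels have
  different labels, hence \<open>v\<close> separates them, and the pair consisting of
  \<open>v\<close> and \<open>xs ! i\<close> is already settled.\<close>

lemma polar_lists_module_side:
  assumes G: "is_graph G" and P: "polar_lists G b v xs ys" and M: "is_module G M"
    and "i < j" "j < length xs" "xs ! i \<in> M" "xs ! j \<in> M"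
  shows "M = gV G"
proof -
  note abs = module_absorbs[OF M G]
  have sx: "staged (gE G) (\<lambda>i. even i = b) (xs @ [v])" using P by (auto simp: polar_lists_def)
  note X = staged_snocD[OF sx]
  have i1: "xs ! Suc i \<in> M"
  proof (cases "j = Suc i")
    case False
    show ?thesis
      by (rule abs[OF assms(6,7)]) (use X(1)[of i "Suc i"] X(1)[of "Suc i" j] False assms(4,5)
          is_graph_sym[OF G] in auto)
  qed (use assms in auto)
  have "v \<in> M"
    by (rule abs[OF assms(6) i1]) (use X(2)[of i] X(2)[of "Suc i"] assms(4,5) is_graph_sym[OF G] in auto)
  then show ?thesis using polar_lists_module_center[OF G P M, of i] assms by auto
qed

text \<open>The first vertex of either list separates a later vertex of that list from any vertex of
  the other list, so both first vertices become members. One list has a second element because there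
  are at least three list elements; it separates the two first vertices and gives a pair on one
  side.\<close>

lemma polar_lists_module_across:
  assumes G: "is_graph G" and P: "polar_lists G b v xs ys" and M: "is_module G M"
    and "i < length xs" "j < length ys" "xs ! i \<in> M" "ys ! j \<in> M"
  shows "M = gV G"
proof -
  note abs = module_absorbs[OF M G]
  have sx: "staged (gE G) (\<lambda>i. even i = b) (xs @ [v])" and sy: "staged (gE G) (\<lambda>i. even i = b) (ys @ [v])"
    and cr: "\<And>x y. x \<in> set xs \<Longrightarrow> y \<in> set ys \<Longrightarrow> (x, y) \<in> gE G \<longleftrightarrow> \<not> b"
    and ne: "xs \<noteq> []" "ys \<noteq> []" and l: "length xs + length ys \<ge> 3"
    using P by (auto simp: polar_lists_def)
  note X = staged_snocD[OF sx] and Y = staged_snocD[OF sy]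
  have x0: "xs ! 0 \<in> set xs" and y0: "ys ! 0 \<in> set ys" using ne by (simp_all)
  have x0M: "xs ! 0 \<in> M"
  proof (cases "i = 0")
    case False
    show ?thesis
      by (rule abs[OF assms(6,7)])
        (use X(1)[of 0 i] False assms(4,5) cr[OF x0, of "ys ! j"] is_graph_sym[OF G] in auto)
  qed (use assms in simp)
  have y0M: "ys ! 0 \<in> M"
  proof (cases "j = 0")
    case False
    show ?thesis
      by (rule abs[OF assms(7,6)])
        (use Y(1)[of 0 j] False assms(4,5) cr[OF _ y0, of "xs ! i"] is_graph_sym[OF G] in auto)
  qed (use assms in simp)
  consider "1 < length xs" | "1 < length ys" using l ne by (cases xs; cases ys) force+
  then show ?thesis
  proof cases
    case 1
    have "xs ! 1 \<in> M"
      by (rule abs[OF x0M y0M]) (use 1 X(1)[of 0 1] cr[OF _ y0, of "xs ! 1"] is_graph_sym[OF G] in auto)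
    then show ?thesis using polar_lists_module_side[OF G P M, of 0 1] 1 x0M by simp
  next
    case 2
    have "ys ! 1 \<in> M"
      by (rule abs[OF y0M x0M]) (use 2 Y(1)[of 0 1] cr[OF x0, of "ys ! 1"] is_graph_sym[OF G] in auto)
    then show ?thesis
      using polar_lists_module_side[OF G polar_lists_swap[OF G P] M, of 0 1] 2 y0M by simp
  qed
qed

lemma polar_lists_primitive:
  assumes G: "is_graph G" and P: "polar_lists G b v xs ys"
  shows "primitive G"
  unfolding primitive_def
proof (intro conjI allI impI)
  have d: "distinct (v # xs @ ys)" and V: "gV G = set (v # xs @ ys)" and l: "length xs + length ys \<ge> 3"
    using P by (auto simp: polar_lists_def)
  show "card (gV G) \<ge> 4" unfolding V using distinct_card[OF d] l by simp
  fix M assume M: "is_module G M"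
  note Q = polar_lists_swap[OF G P]
  have "M = gV G" if "p \<in> M" "q \<in> M" "p \<noteq> q" for p q
  proof -
    have idx: "x = v \<or> (\<exists>i<length xs. x = xs ! i) \<or> (\<exists>i<length ys. x = ys ! i)" if "x \<in> M" for x
    proof -
      have "x \<in> set (v # xs @ ys)" using M that V by (auto simp: is_module_def)
      then show ?thesis unfolding set_append list.set by (metis Un_iff in_set_conv_nth insert_iff)
    qed
    have C: "M = gV G" if "v \<in> M" "x \<in> M" "x \<noteq> v" for x
      using idx[OF that(2)] that polar_lists_module_center[OF G P M] polar_lists_module_center[OF G Q M] by metis
    show ?thesis
    proof (cases "p = v \<or> q = v")
      case True then show ?thesis using C that by metis
    next
      case False
      have X: "M = gV G" if "i \<noteq> j" "i < length xs" "j < length xs" "xs ! i \<in> M" "xs ! j \<in> M" for i j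
        using that polar_lists_module_side[OF G P M, of i j] polar_lists_module_side[OF G P M, of j i] by linarith
      have Y: "M = gV G" if "i \<noteq> j" "i < length ys" "j < length ys" "ys ! i \<in> M" "ys ! j \<in> M" for i j
        using that polar_lists_module_side[OF G Q M, of i j] polar_lists_module_side[OF G Q M, of j i] by linarith
      note XY = polar_lists_module_across[OF G P M]
      from False idx[OF that(1)] idx[OF that(2)] show ?thesis
        by (elim disjE exE conjE) (use that X Y XY in \<open>simp; metis\<close>)+
    qed
  qed
  then show "M = {} \<or> M = gV G \<or> (\<exists>x. M = {x})" by blast
qed

section \<open>Blocks and ears\<close>

lemma uconnected_on_mono:
  assumes "uconnected_on E A" "x \<in> A" "y \<in> A" "A \<subseteq> B"
  shows "(x, y) \<in> ((E \<union> E\<inverse>) \<inter> (B \<times> B))\<^sup>*"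
proof -
  have "(x, y) \<in> ((E \<union> E\<inverse>) \<inter> (A \<times> A))\<^sup>*" using assms by (simp add: uconnected_on_def)
  moreover have "((E \<union> E\<inverse>) \<inter> (A \<times> A))\<^sup>* \<subseteq> ((E \<union> E\<inverse>) \<inter> (B \<times> B))\<^sup>*"
    using assms(4) by (intro rtrancl_mono) auto
  ultimately show ?thesis by blast
qed

lemma uconnected_on_Un:
  assumes "uconnected_on E A" "uconnected_on E B" "c \<in> A" "c \<in> B"
  shows "uconnected_on E (A \<union> B)"
proof -
  have "(x, c) \<in> ((E \<union> E\<inverse>) \<inter> ((A \<union> B) \<times> (A \<union> B)))\<^sup>* \<and>
      (c, x) \<in> ((E \<union> E\<inverse>) \<inter> ((A \<union> B) \<times> (A \<union> B)))\<^sup>*" if "x \<in> A \<union> B" for x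
    using that uconnected_on_mono[OF assms(1), of x c "A \<union> B"] uconnected_on_mono[OF assms(1), of c x "A \<union> B"]
      uconnected_on_mono[OF assms(2), of x c "A \<union> B"] uconnected_on_mono[OF assms(2), of c x "A \<union> B"] assms(3,4)
    by auto
  then show ?thesis unfolding uconnected_on_def using assms(3) by (blast intro: rtrancl_trans)
qed

lemma uconnected_on_singleton: "uconnected_on E {x}"
  by (simp add: uconnected_on_def)

lemma uconnected_on_edge: "(x, y) \<in> E \<union> E\<inverse> \<Longrightarrow> uconnected_on E {x, y}"
  by (auto simp: uconnected_on_def intro!: r_into_rtrancl)

lemma uconnected_on_walk:
  assumes "successively (\<lambda>x y. (x, y) \<in> E \<union> E\<inverse>) zs" "zs \<noteq> []"
  shows "uconnected_on E (set zs)"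
  using assms
proof (induction zs rule: induct_list012)
  case (3 x y zs)
  then have "uconnected_on E ({x, y} \<union> set (y # zs))"
    by (intro uconnected_on_Un[of _ _ _ y] uconnected_on_edge) auto
  then show ?case by (simp add: insert_commute)
qed (auto simp: uconnected_on_singleton)

text \<open>The starting block for \<open>cycle_exists\<close>, where the cycle arises as an ear
  attached to a single edge.\<close>

lemma biconnected_on_edge:
  assumes "(x, y) \<in> E" "x \<noteq> y" shows "biconnected_on E {x, y}"
proof -
  have "{x, y} - {x} = {y}" "{x, y} - {y} = {x}" using assms by auto
  then show ?thesis
    unfolding biconnected_on_def using assms by (auto simp: uconnected_on_singleton intro!: uconnected_on_edge)
qed

text \<open>If a vertex of \<open>W\<close> is removed, the whole ear still hangs on an end that
  survives. If an inner vertex of the ear is removed, the ear falls into two pieces, each attached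
  to \<open>W\<close> at its own end.\<close>

lemma biconnected_on_ear:
  assumes W: "biconnected_on E W" "finite W" and b: "b \<in> W" "b' \<in> W" "b \<noteq> b'"
    and ks: "set ks \<inter> W = {}" "distinct ks" "successively (\<lambda>x y. (x, y) \<in> E \<union> E\<inverse>) (b # ks @ [b'])"
  shows "biconnected_on E (W \<union> set ks)"
  unfolding biconnected_on_def
proof (intro conjI ballI)
  note Un = uconnected_on_Un and walk = uconnected_on_walk
  have Wc: "uconnected_on E W" "\<And>w. w \<in> W \<Longrightarrow> uconnected_on E (W - {w})" and "card W \<ge> 2"
    using W by (auto simp: biconnected_on_def)
  show "card (W \<union> set ks) \<ge> 2"
    using card_mono[of "W \<union> set ks" W] W \<open>card W \<ge> 2\<close> by auto
  have s: "successively (\<lambda>x y. (x, y) \<in> E \<union> E\<inverse>) (b # ks)"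
    and s': "successively (\<lambda>x y. (x, y) \<in> E \<union> E\<inverse>) (ks @ [b'])"
    using ks(3) successively_append_iff[of _ "b # ks" "[b']"] successively_append_iff[of _ "[b]" "ks @ [b']"] by auto
  show "uconnected_on E (W \<union> set ks)"
    using Un[OF Wc(1) walk[OF s], of b] b by (simp add: insert_absorb)
  fix w assume w: "w \<in> W \<union> set ks"
  show "uconnected_on E (W \<union> set ks - {w})"
  proof (cases "w \<in> W")
    case True
    show ?thesis
    proof (cases "w = b")
      case w: True
      have "uconnected_on E ((W - {b}) \<union> set (ks @ [b']))"
        by (rule Un[of _ _ _ b']) (use Wc walk[OF s'] b in auto)
      also have "(W - {b}) \<union> set (ks @ [b']) = W \<union> set ks - {w}" using w b ks(1) by auto
      finally show ?thesis .
    next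
      case False
      have "uconnected_on E ((W - {w}) \<union> set (b # ks))"
        by (rule Un[of _ _ _ b]) (use Wc walk[OF s] b True False in auto)
      also have "(W - {w}) \<union> set (b # ks) = W \<union> set ks - {w}" using True False b ks(1) by auto
      finally show ?thesis .
    qed
  next
    case False
    then obtain as bs where ab: "ks = as @ w # bs" using w split_list by fastforce
    have sa: "successively (\<lambda>x y. (x, y) \<in> E \<union> E\<inverse>) (b # as)"
      using s ab successively_append_iff[of _ "b # as" "w # bs"] by auto
    have sb: "successively (\<lambda>x y. (x, y) \<in> E \<union> E\<inverse>) (bs @ [b'])"
      using s' ab successively_append_iff[of _ "as @ [w]" "bs @ [b']"] by auto
    have "uconnected_on E (W \<union> set (b # as) \<union> set (bs @ [b']))"
      by (rule Un[of _ _ _ b'], rule Un[of _ _ _ b]) (use Wc walk[OF sa] walk[OF sb] b in auto)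
    also have "W \<union> set (b # as) \<union> set (bs @ [b']) = W \<union> set ks - {w}"
      using ab b False ks(2) by auto
    finally show ?thesis .
  qed
qed

lemma trancl_walk:
  assumes "(b, k) \<in> F\<^sup>+" shows "\<exists>ks. successively (\<lambda>x y. (x, y) \<in> F) (b # ks @ [k])"
  using assms
proof (induction rule: trancl_induct)
  case (base y)
  then show ?case by (intro exI[of _ "[]"]) auto
next
  case (step y z)
  then obtain ks where ks: "successively (\<lambda>x y. (x, y) \<in> F) ((b # ks @ [y]))" by auto
  show ?case
    by (rule exI[of _ "ks @ [y]"])
      (use ks step successively_append_iff[of "\<lambda>x y. (x, y) \<in> F" "b # ks @ [y]" "[z]"] in auto)
qed

lemma walk_sorted:
  assumes "successively (\<lambda>x y. (x, y) \<in> F) zs" shows "sorted_wrt (\<lambda>x y. (x, y) \<in> F\<^sup>+) zs"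
proof -
  have "successively (\<lambda>x y. (x, y) \<in> F\<^sup>+) zs"
    using assms by (rule successively_mono) auto
  then show ?thesis
    by (subst (asm) successively_conv_sorted_wrt) (auto simp: transp_on_def)
qed

text \<open>Walks from \<open>b1\<close> and \<open>b2\<close> that leave \<open>W\<close> at once and run to a topologically first
  common descendant \<open>k\<close> are disjoint, so together they form an ear of \<open>W\<close>, and \<open>k\<close> has two
  parents on it.\<close>
lemma meeting_ear:
  assumes fin: "finite E" and acyc: "acyclic E" and W: "biconnected_on E W" "finite W"
    and b: "b1 \<in> W" "b2 \<in> W" "b1 \<noteq> b2" and F: "F = E \<inter> (UNIV \<times> - W)"
    and k0: "(b1, k0) \<in> F\<^sup>+" "(b2, k0) \<in> F\<^sup>+"
  obtains ks1 ks2 k where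
    "successively (\<lambda>x y. (x, y) \<in> F) (b1 # ks1 @ [k])" "successively (\<lambda>x y. (x, y) \<in> F) (b2 # ks2 @ [k])"
    "distinct (ks1 @ k # ks2)" "(set ks1 \<union> set ks2 \<union> {k}) \<inter> W = {}"
    "biconnected_on E (W \<union> (set ks1 \<union> set ks2 \<union> {k}))"
    "last (b1 # ks1) \<noteq> last (b2 # ks2)" "(last (b1 # ks1), k) \<in> E" "(last (b2 # ks2), k) \<in> E"
proof -
  have FE: "F \<subseteq> E" using F by auto
  have acF: "acyclic F" using acyc FE by (rule acyclic_subset)
  have wf: "wf (F\<^sup>+)"
    using finite_acyclic_wf[OF finite_subset[OF FE fin] acF] by (rule wf_trancl)
  have outF: "y \<notin> W" if "(x, y) \<in> F\<^sup>+" for x y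
    using that by (induction rule: trancl_induct) (auto simp: F)
  obtain k where k: "(b1, k) \<in> F\<^sup>+" "(b2, k) \<in> F\<^sup>+"
    and min: "\<And>y. (y, k) \<in> F\<^sup>+ \<Longrightarrow> \<not> ((b1, y) \<in> F\<^sup>+ \<and> (b2, y) \<in> F\<^sup>+)"
    using wfE_min[OF wf, of k0 "{k. (b1, k) \<in> F\<^sup>+ \<and> (b2, k) \<in> F\<^sup>+}"] k0 by auto
  obtain ks1 ks2 where s: "successively (\<lambda>x y. (x, y) \<in> F) (b1 # ks1 @ [k])"
      "successively (\<lambda>x y. (x, y) \<in> F) (b2 # ks2 @ [k])"
    using trancl_walk[OF k(1)] trancl_walk[OF k(2)] by auto
  have irr: "(x, x) \<notin> F\<^sup>+" for x using acF by (simp add: acyclic_def)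
  have S: "sorted_wrt (\<lambda>x y. (x, y) \<in> F\<^sup>+) ks1" "sorted_wrt (\<lambda>x y. (x, y) \<in> F\<^sup>+) ks2"
    "\<And>w. w \<in> set ks1 \<Longrightarrow> (b1, w) \<in> F\<^sup>+ \<and> (w, k) \<in> F\<^sup>+"
    "\<And>w. w \<in> set ks2 \<Longrightarrow> (b2, w) \<in> F\<^sup>+ \<and> (w, k) \<in> F\<^sup>+"
    using walk_sorted[OF s(1)] walk_sorted[OF s(2)] by (auto simp: sorted_wrt_append)
  have dis: "distinct zs" if "sorted_wrt (\<lambda>x y. (x, y) \<in> F\<^sup>+) zs" for zs
    using that irr by (induction zs) auto
  have d: "distinct (ks1 @ k # ks2)"
    using dis[OF S(1)] dis[OF S(2)] S(3,4) irr min by auto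
  have out: "(set ks1 \<union> set ks2 \<union> {k}) \<inter> W = {}" using S(3,4) k outF by blast
  have l: "(last (b1 # ks1), k) \<in> F" "(last (b2 # ks2), k) \<in> F"
    using s successively_append_iff[of _ "b1 # ks1" "[k]"] successively_append_iff[of _ "b2 # ks2" "[k]"] by auto
  \<comment> \<open>The walks share no inner vertex, their starts are distinct, and inner vertices
    lie outside \<open>W\<close>; thus \<open>k\<close> is entered from two different
    vertices.\<close>
  have ne: "last (b1 # ks1) \<noteq> last (b2 # ks2)"
    using d out b by (cases ks1 rule: rev_cases; cases ks2 rule: rev_cases) auto
  let ?U = "\<lambda>x y. (x, y) \<in> E \<union> E\<inverse>"
  have u1: "successively ?U (b1 # ks1 @ [k])" by (rule successively_mono[OF s(1)]) (use FE in auto)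
  have u2: "successively ?U (rev (b2 # ks2 @ [k]))"
    unfolding successively_rev by (rule successively_mono[OF s(2)]) (use FE in auto)
  \<comment> \<open>The ear runs down the first walk to \<open>k\<close> and back up the second one,
    which is possible because directions are ignored in \<open>?U\<close>.\<close>
  have "successively ?U (b1 # (ks1 @ k # rev ks2) @ [b2])"
    using u1 u2 successively_append_iff[of ?U "b1 # ks1" "k # rev ks2 @ [b2]"]
      successively_append_iff[of ?U "b1 # ks1" "[k]"] by auto
  from biconnected_on_ear[OF W b _ _ this]
  have "biconnected_on E (W \<union> set (ks1 @ k # rev ks2))" using d out by auto
  then have bi: "biconnected_on E (W \<union> (set ks1 \<union> set ks2 \<union> {k}))"
    by (simp add: Un_commute Un_left_commute)
  show ?thesis using that[OF s d out bi ne] l FE by blast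
qed

section \<open>Parts of a network entered from a single vertex, and lowest common ancestors\<close>

definition pending :: "('v \<times> 'v) set \<Rightarrow> 'v set \<Rightarrow> 'v \<Rightarrow> bool" where
  "pending E S u \<longleftrightarrow> (\<forall>a b. (a, b) \<in> E \<longrightarrow> (a \<in> S \<longrightarrow> b \<in> S) \<and> (b \<in> S \<longrightarrow> a \<in> S \<or> a = u)) \<and>
     (\<forall>x\<in>S. (u, x) \<in> E\<^sup>*)"

lemma pending_down:
  assumes "pending E S u" "(w, x) \<in> E\<^sup>*" "w \<in> S" shows "x \<in> S"
  using assms(2,3,1) by (induction rule: rtrancl_induct) (auto simp: pending_def)

text \<open>A path followed upwards from \<open>x\<close> can leave \<open>S\<close> only through an
  edge whose tail is \<open>u\<close>.\<close>

lemma pending_up: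
  assumes "pending E S u" "(w, x) \<in> E\<^sup>*" "x \<in> S" shows "w \<in> S \<or> (w, u) \<in> E\<^sup>*"
  using assms(2,3,1)
proof (induction rule: converse_rtrancl_induct)
  case (step y z)
  from step.IH[OF step.prems] show ?case
  proof
    assume "z \<in> S"
    then have "y \<in> S \<or> y = u" using step.hyps(1) assms(1) unfolding pending_def by blast
    then show ?thesis by auto
  qed (use step.hyps(1) in \<open>auto intro: converse_rtrancl_into_rtrancl\<close>)
qed auto

lemma lca_commute: "lca E x y = lca E y x"
proof -
  have "is_lca E x y = is_lca E y x" by (auto simp: is_lca_def fun_eq_iff)
  then show ?thesis by (simp add: lca_def)
qed

text \<open>The common ancestors of \<open>x\<close> and \<open>z\<close> are those of \<open>u\<close> and \<open>z\<close>, whatever \<open>x \<in> S\<close> is. This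
  needs no uniqueness of lowest common ancestors: both descriptions in \<open>lca\<close> coincide.\<close>
lemma pending_lca:
  assumes S: "pending E S u" and "x \<in> S" "y \<in> S" "z \<notin> S"
  shows "lca E x z = lca E y z"
proof -
  have *: "(w, x) \<in> E\<^sup>* \<and> (w, z) \<in> E\<^sup>* \<longleftrightarrow> (w, u) \<in> E\<^sup>* \<and> (w, z) \<in> E\<^sup>*" if "x \<in> S" for w x
  proof -
    have "(u, x) \<in> E\<^sup>*" using S that by (auto simp: pending_def)
    then show ?thesis
      using pending_up[OF S, of w x] pending_down[OF S, of w z] that assms(4) by (meson rtrancl_trans)
  qed
  have "is_lca E x z = is_lca E y z"
    unfolding is_lca_def fun_eq_iff using *[OF assms(2)] *[OF assms(3)] by metis
  then show ?thesis by (simp add: lca_def)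
qed

text \<open>The definite description in \<open>lca\<close> needs uniqueness, which minimality alone
  does not provide. If every common ancestor lies above \<open>u\<close>, then so does a minimal
  one, and its minimality forces it to be \<open>u\<close>.\<close>

lemma lca_eqI:
  assumes "acyclic E" "(u, x) \<in> E\<^sup>*" "(u, y) \<in> E\<^sup>*"
    "\<And>w. (w, x) \<in> E\<^sup>* \<Longrightarrow> (w, y) \<in> E\<^sup>* \<Longrightarrow> (w, u) \<in> E\<^sup>*"
  shows "lca E x y = u"
proof -
  have anti: "a = b" if "(a, b) \<in> E\<^sup>*" "(b, a) \<in> E\<^sup>*" for a b
    using acyclic_impl_antisym_rtrancl[OF assms(1)] that by (auto simp: antisym_def)
  show ?thesis unfolding lca_def
  proof (rule the_equality)
    show "is_lca E x y u" unfolding is_lca_def using assms anti by blast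
  next
    fix u' assume u': "is_lca E x y u'"
    then have "(u', u) \<in> E\<^sup>*" using assms(4) unfolding is_lca_def by blast
    then show "u' = u" using u' assms(2,3) unfolding is_lca_def by blast
  qed
qed

text \<open>The level-1 condition speaks of maximal biconnected sets only; in a finite network every
  biconnected set is contained in one of them.\<close>

lemma level1_hybrid_unique:
  assumes N: "level1_network V E X" and W: "biconnected_on E W" "W \<subseteq> V"
    and u: "u \<in> W" "u' \<in> W" "hybrid E u" "hybrid E u'"
  shows "u = u'"
proof -
  have fin: "finite V" using N by (auto simp: level1_network_def is_network_def)
  let ?C = "{W'. W \<subseteq> W' \<and> W' \<subseteq> V \<and> biconnected_on E W'}"
  have "finite ?C" using fin by (intro finite_subset[of ?C "Pow V"]) auto
  from finite_has_maximal2[OF this, of W] W obtain M where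
    M: "W \<subseteq> M" "M \<in> ?C" "\<forall>W'\<in>?C. M \<subseteq> W' \<longrightarrow> M = W'"
    by (simp only: mem_Collect_eq) blast
  have "biconnected_component V E M" unfolding biconnected_component_def
  proof (intro conjI allI impI)
    fix W' assume "M \<subseteq> W'" "W' \<subseteq> V" "biconnected_on E W'"
    then show "W' = M" using M(1) bspec[OF M(3), of W'] by auto
  qed (use M(2) in auto)
  then have "card {u\<in>M. hybrid E u} \<le> 1" using N by (auto simp: level1_network_def)
  moreover have "finite {u\<in>M. hybrid E u}" using M(2) fin by (auto intro: finite_subset[of _ V])
  ultimately show ?thesis using u M(1) M(2) card_le_Suc0_iff_eq[of "{u\<in>M. hybrid E u}"] by auto
qed

section \<open>Networks explaining primitive graphs\<close>

text \<open>The non-degenerate alternative of \<open>is_network\<close> with the root fixed as a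
  parameter. Primitive graphs have at least four vertices, so the one-vertex network cannot explain
  them.\<close>

locale rooted_network =
  fixes V :: "'v set" and E :: "('v \<times> 'v) set" and X :: "'v set" and \<rho> :: 'v
  assumes finV: "finite V" and EV: "E \<subseteq> V \<times> V" and acyc: "acyclic E" and XV: "X \<subseteq> V"
    and root: "\<rho> \<in> V" "indeg E \<rho> = 0" "outdeg E \<rho> \<ge> 2"
    and root_unique: "\<And>u. u \<in> V \<Longrightarrow> indeg E u = 0 \<Longrightarrow> u = \<rho>"
    and leaf_iff: "\<And>x. x \<in> V \<Longrightarrow> x \<in> X \<longleftrightarrow> outdeg E x = 0 \<and> indeg E x = 1"
    and inner: "\<And>u. u \<in> V \<Longrightarrow> indeg E u \<noteq> 0 \<Longrightarrow> u \<notin> X \<Longrightarrow>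
      (indeg E u = 1 \<and> outdeg E u \<ge> 2) \<or> (indeg E u = 2 \<and> outdeg E u \<ge> 1)"

lemma network_rooted:
  assumes "is_network V E X" "card X \<noteq> 1"
  shows "\<exists>\<rho>. rooted_network V E X \<rho>"
proof -
  have "\<not> (\<exists>x. V = {x} \<and> X = {x})" using assms(2) by auto
  then obtain \<rho> where r: "\<rho>\<in>V" "indeg E \<rho> = 0" "outdeg E \<rho> \<ge> 2" "\<forall>u\<in>V. indeg E u = 0 \<longrightarrow> u = \<rho>"
    "\<forall>x\<in>V. x \<in> X \<longleftrightarrow> outdeg E x = 0 \<and> indeg E x = 1"
    "\<forall>u\<in>V. indeg E u \<noteq> 0 \<longrightarrow> u \<notin> X \<longrightarrow>
          (indeg E u = 1 \<and> outdeg E u \<ge> 2) \<or> (indeg E u = 2 \<and> outdeg E u \<ge> 1)"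
    using assms(1) unfolding is_network_def by blast
  have N: "finite V" "E \<subseteq> V \<times> V" "acyclic E" "X \<subseteq> V" using assms(1) by (simp_all add: is_network_def)
  have "rooted_network V E X \<rho>"
    by (rule rooted_network.intro[OF N r(1-3)]) (use r(4) in blast, rule r(5)[rule_format], assumption,
        rule r(6)[rule_format])
  then show ?thesis ..
qed

context rooted_network
begin

lemma finE: "finite E"
  using EV finV by (meson finite_SigmaI finite_subset)

lemma fin_pred: "finite {y. (y, u) \<in> E}" and fin_succ: "finite {y. (u, y) \<in> E}"
  using EV finV by (auto intro: finite_subset[of _ V])

lemma no_pred_root: "(y, \<rho>) \<notin> E"
  using root(2) fin_pred[of \<rho>] by (auto simp: indeg_def)

lemma pred_ex: "u \<in> V \<Longrightarrow> u \<noteq> \<rho> \<Longrightarrow> \<exists>y. (y, u) \<in> E"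
  using root_unique[of u] fin_pred[of u] by (auto simp: indeg_def)

lemma root_reaches:
  assumes "u \<in> V" shows "(\<rho>, u) \<in> E\<^sup>*"
proof -
  have "wf E" using finite_acyclic_wf[OF finE acyc] .
  then show ?thesis using assms
  proof (induction u rule: wf_induct_rule)
    case (less u)
    show ?case
    proof (cases "u = \<rho>")
      case False
      then obtain y where y: "(y, u) \<in> E" using pred_ex less.prems by blast
      then have "(\<rho>, y) \<in> E\<^sup>*" using less.IH EV by blast
      then show ?thesis using y by simp
    qed simp
  qed
qed

lemma leaf_no_succ: "x \<in> X \<Longrightarrow> (x, y) \<notin> E"
  using leaf_iff[of x] XV fin_succ[of x] by (auto simp: outdeg_def)

lemma root_no_leaf: "\<rho> \<notin> X"
  using leaf_iff[of \<rho>] root by simp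

lemma leaf_below:
  assumes "u \<in> V" shows "\<exists>x\<in>X. (u, x) \<in> E\<^sup>*"
proof -
  have "wf (E\<inverse>)" using finite_acyclic_wf_converse[OF finE acyc] .
  then show ?thesis using assms
  proof (induction u rule: wf_induct_rule)
    case (less u)
    show ?case
    proof (cases "\<exists>y. (u, y) \<in> E")
      case True
      then obtain y where y: "(u, y) \<in> E" by blast
      then obtain x where "x \<in> X" "(y, x) \<in> E\<^sup>*" using less.IH EV by blast
      then show ?thesis using y by (meson converse_rtrancl_into_rtrancl)
    next
      case False
      then have o: "outdeg E u = 0" by (simp add: outdeg_def)
      then have "u \<noteq> \<rho>" using root by auto
      then have "indeg E u \<noteq> 0" using root_unique less.prems by blast
      then have "u \<in> X" using inner[OF less.prems] o by auto
      then show ?thesis by blast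
    qed
  qed
qed

text \<open>Two distinct parents give indegree at least 2, and the degree conditions of a network
  allow nothing larger.\<close>

lemma hybridI:
  assumes "(y, u) \<in> E" "(y', u) \<in> E" "y \<noteq> y'" shows "hybrid E u"
proof -
  have "card {y, y'} \<le> indeg E u" unfolding indeg_def using assms fin_pred by (intro card_mono) auto
  then have "indeg E u \<ge> 2" using assms by simp
  moreover have "u \<in> V" using assms EV by auto
  ultimately show ?thesis using inner[of u] leaf_iff[of u] by (auto simp: hybrid_def)
qed

lemma hybrid_preds:
  assumes "(y, u) \<in> E" "(y', u) \<in> E" "y \<noteq> y'" shows "(z, u) \<in> E \<longleftrightarrow> z = y \<or> z = y'"
proof -
  have "card {y. (y, u) \<in> E} = 2" using hybridI[OF assms] by (simp add: hybrid_def indeg_def)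
  moreover have "{y, y'} \<subseteq> {y. (y, u) \<in> E}" "card {y, y'} = 2" using assms by auto
  ultimately have "{y, y'} = {y. (y, u) \<in> E}" using fin_pred card_subset_eq by metis
  then show ?thesis by auto
qed

lemma hybrid_no_leaf: "hybrid E u \<Longrightarrow> u \<notin> X"
  using leaf_iff[of u] XV by (auto simp: hybrid_def)

lemma succ_unless_leaf: "u \<in> V \<Longrightarrow> u \<notin> X \<Longrightarrow> \<exists>y. (u, y) \<in> E"
  using leaf_below[of u] by (metis converse_rtranclE)

lemma two_succ:
  assumes "u \<in> V" "u \<notin> X" "\<not> hybrid E u" shows "\<exists>y. (u, y) \<in> E \<and> y \<noteq> z"
proof -
  have "outdeg E u \<ge> 2" 
  proof (cases "u = \<rho>")
    case False
    then show ?thesis using inner[of u] assms root_unique[of u] unfolding hybrid_def by blast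
  qed (use root in simp)
  then have "\<not> {y. (u, y) \<in> E} \<subseteq> {z}"
    using card_mono[of "{z}" "{y. (u, y) \<in> E}"] by (auto simp: outdeg_def)
  then show ?thesis by blast
qed

lemma acyc': "(x, x) \<notin> E\<^sup>+" using acyc by (simp add: acyclic_def)

end

section \<open>Modules from pending parts, and the cycle through the root\<close>

locale explained = rooted_network +
  fixes t :: "'v \<Rightarrow> label" and \<phi> :: "'v \<Rightarrow> 'a" and G :: "'a graph"
  assumes G: "is_graph G" and prim: "primitive G" and expl: "explains_via E X t \<phi> G"
    and level1: "level1_network V E X"
begin

lemma bij: "bij_betw \<phi> X (gV G)"
  using expl by (simp add: explains_via_def)

lemma adj: "x \<in> X \<Longrightarrow> y \<in> X \<Longrightarrow> x \<noteq> y \<Longrightarrow> (\<phi> x, \<phi> y) \<in> gE G \<longleftrightarrow> t (lca E x y) = Lab1"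
  using expl by (simp add: explains_via_def)

lemma card_X: "card X \<ge> 4"
  using prim bij_betw_same_card[OF bij] by (simp add: primitive_def)

text \<open>By \<open>pending_lca\<close> a leaf outside \<open>S\<close> has the same lowest common
  ancestor with all leaves in \<open>S\<close>, so their images form a module, and primitivity
  leaves only the trivial ones.\<close>

lemma pending_leaves:
  assumes S: "pending E S u"
  shows "X \<inter> S = {} \<or> X \<subseteq> S \<or> (\<exists>x. X \<inter> S = {x})"
proof -
  let ?M = "\<phi> ` (X \<inter> S)"
  have inj: "inj_on \<phi> X" and img: "\<phi> ` X = gV G" using bij by (auto simp: bij_betw_def)
  have "is_module G ?M" unfolding is_module_def
  proof (intro conjI ballI)
    show "?M \<subseteq> gV G" using img by auto
    have *: "nbhd G (\<phi> x) - ?M \<subseteq> nbhd G (\<phi> y) - ?M" if xy: "x \<in> X \<inter> S" "y \<in> X \<inter> S" for x y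
    proof
      fix w assume w: "w \<in> nbhd G (\<phi> x) - ?M"
      then have "w \<in> gV G" using G by (auto simp: nbhd_def is_graph_def)
      then obtain z where z: "z \<in> X" "w = \<phi> z" using img by auto
      then have "z \<notin> S" using w by auto
      then have "lca E x z = lca E y z" using pending_lca[OF S] xy by auto
      then show "w \<in> nbhd G (\<phi> y) - ?M" using w z xy \<open>z \<notin> S\<close> adj[of x z] adj[of y z]
        by (auto simp: nbhd_def)
    qed
    fix p q assume "p \<in> ?M" "q \<in> ?M"
    then show "nbhd G p - ?M = nbhd G q - ?M" using * by blast
  qed
  then consider "?M = {}" | "?M = gV G" | p where "?M = {p}" using prim unfolding primitive_def by blast
  then show ?thesis
  proof cases
    case 2
    then have "\<phi> ` (X \<inter> S) = \<phi> ` X" using img by simp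
    then have "X \<inter> S = X" using inj by (simp add: inj_on_image_eq_iff)
    then show ?thesis by auto
  next
    case (3 p)
    have "inj_on \<phi> (X \<inter> S)" using inj by (rule inj_on_subset) auto
    then have "card (X \<inter> S) = 1" using 3 card_image by fastforce
    then show ?thesis by (auto simp: card_1_singleton_iff)
  qed auto
qed

text \<open>The rest of the network below the root is pending at the root, too, so both leaf sets have at
  most one element, or one of them is everything.\<close>
lemma pending_root:
  assumes S: "pending E S \<rho>" and "\<rho> \<notin> S" "S \<subseteq> V"
  shows "X \<inter> S = {} \<or> X \<subseteq> S"
proof -
  let ?T = "V - {\<rho>} - S"
  have "pending E ?T \<rho>" unfolding pending_def
  proof (intro conjI allI impI ballI)
    fix a b assume ab: "(a, b) \<in> E"
    then have V: "a \<in> V" "b \<in> V" "b \<noteq> \<rho>" using EV no_pred_root by auto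
    show "b \<in> ?T" if "a \<in> ?T" using S ab that V unfolding pending_def by blast
    show "a \<in> ?T \<or> a = \<rho>" if "b \<in> ?T" using S ab that V unfolding pending_def by blast
  qed (use root_reaches in auto)
  note T = pending_leaves[OF this]
  have XT: "X = (X \<inter> S) \<union> (X \<inter> ?T)" using XV root_no_leaf by auto
  show ?thesis
  proof (rule ccontr)
    assume neg: "\<not> ?thesis"
    then obtain x where x: "X \<inter> S = {x}" using pending_leaves[OF S] by auto
    then have "\<not> X \<subseteq> ?T" by auto
    then consider "X \<inter> ?T = {}" | y where "X \<inter> ?T = {y}" using T by auto
    then have "card X \<le> 2" by cases (subst XT, simp add: x card_insert_if)+
    then show False using card_X by simp
  qed
qed

text \<open>Otherwise the descendants of a child \<open>c1\<close> form a part pending at the root: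
  a parent outside it would lie below another child, which would then share a descendant with
  \<open>c1\<close>. By \<open>pending_root\<close> this part has no leaf or all leaves. The first
  contradicts the leaf below \<open>c1\<close>; in the second case a leaf below \<open>c2\<close> is
  a common descendant.\<close>

lemma branching_children:
  "\<exists>c1 c2 k. (\<rho>, c1) \<in> E \<and> (\<rho>, c2) \<in> E \<and> c1 \<noteq> c2 \<and> (c1, k) \<in> E\<^sup>* \<and> (c2, k) \<in> E\<^sup>*"
proof (rule ccontr)
  assume neg: "\<not> ?thesis"
  obtain c1 where c1: "(\<rho>, c1) \<in> E"
    using two_succ[of \<rho>] root root_no_leaf by (auto simp: hybrid_def)
  obtain c2 where c2: "(\<rho>, c2) \<in> E" "c2 \<noteq> c1"
    using two_succ[of \<rho> c1] root root_no_leaf by (auto simp: hybrid_def)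
  let ?S = "{k. (c1, k) \<in> E\<^sup>*}"
  have SV: "?S \<subseteq> V"
  proof
    fix k assume "k \<in> ?S"
    then have "(c1, k) \<in> E\<^sup>*" by simp
    then show "k \<in> V" by (cases rule: rtranclE) (use c1 EV in auto)
  qed
  have nr: "\<rho> \<notin> ?S" using acyc' c1 by (auto dest: rtrancl_into_trancl2)
  have "pending E ?S \<rho>" unfolding pending_def
  proof (intro conjI allI impI ballI)
    fix a b assume ab: "(a, b) \<in> E"
    show "b \<in> ?S" if "a \<in> ?S" using that ab by auto
    show "a \<in> ?S \<or> a = \<rho>" if b: "b \<in> ?S"
    proof (rule ccontr)
      assume n: "\<not> ?thesis"
      have "(\<rho>, a) \<in> E\<^sup>*" using root_reaches ab EV by auto
      then obtain c where c: "(\<rho>, c) \<in> E" "(c, a) \<in> E\<^sup>*" using n by (auto elim: converse_rtranclE)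
      then have "c \<noteq> c1" using n by auto
      moreover have "(c, b) \<in> E\<^sup>*" using c ab by auto
      ultimately show False using neg c c1 b by auto
    qed
  qed (use c1 in \<open>auto intro: converse_rtrancl_into_rtrancl\<close>)
  from pending_root[OF this nr SV] consider "X \<inter> ?S = {}" | "X \<subseteq> ?S" by auto
  then show False
  proof cases
    case 1
    then show False using leaf_below[of c1] c1 EV by auto
  next
    case 2
    then obtain x where "(c1, x) \<in> E\<^sup>*" "(c2, x) \<in> E\<^sup>*" using leaf_below[of c2] c2 EV by auto
    then show False using neg c1 c2 by auto
  qed
qed

text \<open>The edge from \<open>\<rho>\<close> to \<open>c2\<close> is a block, and
  \<open>meeting_ear\<close> applied to it closes the cycle: one walk leaves \<open>\<rho>\<close>
  through \<open>c1\<close>, the other leaves \<open>c2\<close>, and both run to a common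
  descendant, which becomes \<open>h\<close>.\<close>

lemma cycle_exists:
  "\<exists>ps qs h. successively (\<lambda>x y. (x, y) \<in> E) (\<rho> # ps @ [h]) \<and> successively (\<lambda>x y. (x, y) \<in> E) (\<rho> # qs @ [h]) \<and>
     ps @ qs \<noteq> [] \<and> distinct (\<rho> # h # ps @ qs) \<and> biconnected_on E (set (\<rho> # h # ps @ qs))"
proof -
  obtain c1 c2 k where c: "(\<rho>, c1) \<in> E" "(\<rho>, c2) \<in> E" "c1 \<noteq> c2" "(c1, k) \<in> E\<^sup>*" "(c2, k) \<in> E\<^sup>*"
    and nc: "(c1, c2) \<notin> E\<^sup>*"
  proof -
    obtain c1 c2 k where c: "(\<rho>, c1) \<in> E" "(\<rho>, c2) \<in> E" "c1 \<noteq> c2" "(c1, k) \<in> E\<^sup>*" "(c2, k) \<in> E\<^sup>*"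
      using branching_children by blast
    \<comment> \<open>Distinct vertices of an acyclic graph do not reach each other both ways. This
      asymmetric choice keeps the walk from \<open>c1\<close> away from \<open>c2\<close>.\<close>
    have "(c1, c2) \<notin> E\<^sup>* \<or> (c2, c1) \<notin> E\<^sup>*" using c(3) acyclic_impl_antisym_rtrancl[OF acyc]
      unfolding antisym_def by blast
    then show ?thesis using that[of c1 c2 k] that[of c2 c1 k] c by metis
  qed
  let ?W = "{\<rho>, c2}"
  define F where "F = E \<inter> (UNIV \<times> - ?W)"
  have rc: "\<rho> \<noteq> c2" using c no_pred_root by auto
  \<comment> \<open>Such paths never enter \<open>?W\<close>: the root has no parent, and arriving
    at \<open>c2\<close> would give a cycle or a path from \<open>c1\<close> to
    \<open>c2\<close>.\<close>
  have FI: "(a, z) \<in> F\<^sup>*" if "(a, z) \<in> E\<^sup>*" "(c2, a) \<in> E\<^sup>+ \<or> (a = c1)" for a z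
    using that
  proof (induction rule: rtrancl_induct)
    case (step y z)
    have "z \<noteq> \<rho>" using step no_pred_root by auto
    moreover have "z \<noteq> c2"
    proof
      assume "z = c2"
      then have "(a, c2) \<in> E\<^sup>+" using step.hyps by (meson rtrancl_into_trancl1)
      then show False using step.prems nc acyc'[of c2] by (metis trancl_into_rtrancl trancl_trans)
    qed
    ultimately have "(y, z) \<in> F" using step by (simp add: F_def)
    then show ?case using step by auto
  qed simp
  have "c1 \<noteq> \<rho>" using c no_pred_root by auto
  then have "(\<rho>, c1) \<in> F" using c by (simp add: F_def)
  then have k1: "(\<rho>, k) \<in> F\<^sup>+" using FI[OF c(4)] by (auto intro: rtrancl_into_trancl2)
  have "k \<noteq> c2" using c(4) nc by auto
  then obtain d where d: "(c2, d) \<in> E" "(d, k) \<in> E\<^sup>*" using c(5) by (auto elim: converse_rtranclE)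
  have "d \<noteq> \<rho>" "d \<noteq> c2" using d no_pred_root acyc'[of c2] by auto
  then have "(c2, d) \<in> F" using d by (simp add: F_def)
  then have k2: "(c2, k) \<in> F\<^sup>+" using FI[OF d(2)] d(1) by (auto intro: rtrancl_into_trancl2)
  obtain ps qs h where s: "successively (\<lambda>x y. (x, y) \<in> F) (\<rho> # ps @ [h])" "successively (\<lambda>x y. (x, y) \<in> F) (c2 # qs @ [h])"
    and d: "distinct (ps @ h # qs)" "(set ps \<union> set qs \<union> {h}) \<inter> ?W = {}"
    and bi: "biconnected_on E (?W \<union> (set ps \<union> set qs \<union> {h}))"
    by (rule meeting_ear[OF finE acyc biconnected_on_edge[OF c(2) rc] _ _ _ rc F_def k1 k2]) auto
  have s1: "successively (\<lambda>x y. (x, y) \<in> E) (\<rho> # ps @ [h])" "successively (\<lambda>x y. (x, y) \<in> E) (c2 # qs @ [h])"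
    by (rule successively_mono[OF s(1)] successively_mono[OF s(2)]; simp add: F_def)+
  show ?thesis
  proof (intro exI conjI)
    show "successively (\<lambda>x y. (x, y) \<in> E) (\<rho> # ps @ [h])" by (fact s1)
    \<comment> \<open>One side starts with \<open>c2\<close>, so not both sides are empty. The other
      side may still be empty, when \<open>h\<close> is a child of the root.\<close>
    show "successively (\<lambda>x y. (x, y) \<in> E) (\<rho> # (c2 # qs) @ [h])" using s1(2) c(2) by simp
    show "distinct (\<rho> # h # ps @ c2 # qs)" using d rc by auto
    have "set (\<rho> # h # ps @ c2 # qs) = ?W \<union> (set ps \<union> set qs \<union> {h})" by auto
    then show "biconnected_on E (set (\<rho> # h # ps @ c2 # qs))" using bi by simp
  qed simp
qed

end

lemma walk_nth: "successively P zs \<Longrightarrow> Suc i < length zs \<Longrightarrow> P (zs ! i) (zs ! Suc i)"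
proof (induction zs arbitrary: i rule: induct_list012)
  case (3 x y zs)
  then show ?case by (cases i) auto
qed auto

text \<open>Only the heads of edges are required to avoid \<open>B\<close>, so that a walk can start
  in the cycle vertex \<open>b\<close> but never meets the cycle again.\<close>

definition hang :: "('v \<times> 'v) set \<Rightarrow> 'v set \<Rightarrow> 'v \<Rightarrow> 'v set" where
  "hang E B b = {k. (b, k) \<in> (E \<inter> (UNIV \<times> - B))\<^sup>+}"

section \<open>The parts hanging off the cycle and their leaves\<close>

locale cycle_network = explained +
  fixes ps qs :: "'a list" and h :: 'a and B :: "'a set"
  assumes s1: "successively (\<lambda>x y. (x, y) \<in> E) (\<rho> # ps @ [h])"
    and s2: "successively (\<lambda>x y. (x, y) \<in> E) (\<rho> # qs @ [h])"
    and ne: "ps @ qs \<noteq> []" and dist: "distinct (\<rho> # h # ps @ qs)"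
    and B: "B = set (\<rho> # h # ps @ qs)" and bi: "biconnected_on E B"
begin

lemma trancl_V: "(x, y) \<in> E\<^sup>+ \<Longrightarrow> y \<in> V"
  using EV by (auto elim: tranclE)

lemma BV: "B \<subseteq> V"
  using walk_sorted[OF s1] walk_sorted[OF s2] root(1) trancl_V unfolding B by (auto simp: sorted_wrt_append)

text \<open>Writing the parents of \<open>h\<close> as last elements of \<open>\<rho> # ps\<close>
  and \<open>\<rho> # qs\<close> includes an empty side, where the parent is the root.\<close>

lemma last_pred:
  shows "(last (\<rho> # ps), h) \<in> E" "(last (\<rho> # qs), h) \<in> E" "last (\<rho> # ps) \<noteq> last (\<rho> # qs)"
proof -
  show "(last (\<rho> # ps), h) \<in> E" "(last (\<rho> # qs), h) \<in> E"
    using s1 s2 successively_append_iff[of _ "\<rho> # ps" "[h]"] successively_append_iff[of _ "\<rho> # qs" "[h]"] by auto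
  show "last (\<rho> # ps) \<noteq> last (\<rho> # qs)"
    using ne dist by (cases ps rule: rev_cases; cases qs rule: rev_cases) auto
qed

lemma hybrid_h: "hybrid E h"
  using hybridI[OF last_pred] .

lemma hybrid_only_h: "u \<in> B \<Longrightarrow> hybrid E u \<Longrightarrow> u = h"
  using level1_hybrid_unique[OF level1 bi BV, of u h] hybrid_h B by auto

lemma pred_h: "(y, h) \<in> E \<longleftrightarrow> y = last (\<rho> # ps) \<or> y = last (\<rho> # qs)"
  using hybrid_preds[OF last_pred] .

text \<open>A second parent would make \<open>rs ! i\<close> a hybrid-vertex in the block
  \<open>B\<close> besides \<open>h\<close>. The index shift comes from the root at the head of
  \<open>\<rho> # rs\<close>.\<close>

lemma pred_side:
  assumes s: "successively (\<lambda>x y. (x, y) \<in> E) (\<rho> # rs @ [h])" and rs: "set rs \<subseteq> B" "h \<notin> set rs"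
    and i: "i < length rs"
  shows "(y, rs ! i) \<in> E \<longleftrightarrow> y = (\<rho> # rs) ! i"
proof -
  have e: "((\<rho> # rs) ! i, rs ! i) \<in> E"
    using walk_nth[OF s, of i] i by (auto simp: nth_append nth_Cons split: nat.splits)
  have "rs ! i \<in> set rs" using i by simp
  then have "\<not> hybrid E (rs ! i)" using hybrid_only_h rs by blast
  then show ?thesis using e hybridI by blast
qed

lemma side_closed:
  assumes s: "successively (\<lambda>x y. (x, y) \<in> E) (\<rho> # rs @ [h])" and rs: "set rs \<subseteq> B" "h \<notin> set rs"
    and y: "(y, z) \<in> E" "z \<in> insert \<rho> (set rs)"
  shows "y \<in> insert \<rho> (set rs)"
proof -
  obtain i where i: "i < length rs" "z = rs ! i" using y no_pred_root by (auto simp: in_set_conv_nth)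
  then have "y = (\<rho> # rs) ! i" using pred_side[OF s rs] y by auto
  moreover have "(\<rho> # rs) ! i \<in> set (\<rho> # rs)" using i by (intro nth_mem) auto
  ultimately show ?thesis by simp
qed

lemma side_anc:
  assumes "successively (\<lambda>x y. (x, y) \<in> E) (\<rho> # rs @ [h])" "set rs \<subseteq> B" "h \<notin> set rs"
    and "(y, z) \<in> E\<^sup>*" "z \<in> insert \<rho> (set rs)"
  shows "y \<in> insert \<rho> (set rs)"
  using assms(4,5)
  by (induction rule: converse_rtrancl_induct) (use side_closed[OF assms(1-3)] in blast)+

lemma ps_B: "set ps \<subseteq> B" "h \<notin> set ps" and qs_B: "set qs \<subseteq> B" "h \<notin> set qs"
  using dist B by auto

lemma pred_B: assumes "(y, b) \<in> E" "b \<in> B" shows "y \<in> B"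
proof (cases "b = h")
  case True
  then show ?thesis using assms pred_h B by auto
next
  case False
  then have "b \<in> insert \<rho> (set ps) \<or> b \<in> insert \<rho> (set qs)" using assms B by auto
  then show ?thesis using side_closed[OF s1 ps_B assms(1)] side_closed[OF s2 qs_B assms(1)] B by auto
qed

lemma anc_B: assumes "(y, b) \<in> E\<^sup>*" "b \<in> B" shows "y \<in> B"
  using assms by (induction rule: converse_rtrancl_induct) (use pred_B in blast)+

lemma hang_out: "k \<in> hang E B b \<Longrightarrow> k \<notin> B"
  unfolding hang_def by (auto elim: tranclE)

lemma hang_E: "k \<in> hang E B b \<Longrightarrow> (b, k) \<in> E\<^sup>+"
  unfolding hang_def by (auto intro: trancl_mono)

lemma hang_V: "hang E B b \<subseteq> V"
  using hang_E trancl_V by blast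

text \<open>Otherwise an ear with a second hybrid-vertex would be attached to the cycle.\<close>
lemma hang_disjoint:
  assumes b: "b1 \<in> B" "b2 \<in> B" "k \<in> hang E B b1" "k \<in> hang E B b2"
  shows "b1 = b2"
proof (rule ccontr)
  assume ne: "b1 \<noteq> b2"
  define F where "F = E \<inter> (UNIV \<times> - B)"
  have k: "(b1, k) \<in> F\<^sup>+" "(b2, k) \<in> F\<^sup>+" using b by (auto simp: hang_def F_def)
  have fB: "finite B" using BV finV finite_subset by blast
  obtain ks1 ks2 k where s: "successively (\<lambda>x y. (x, y) \<in> F) (b1 # ks1 @ [k])" "successively (\<lambda>x y. (x, y) \<in> F) (b2 # ks2 @ [k])"
    and out: "(set ks1 \<union> set ks2 \<union> {k}) \<inter> B = {}"
    and bic: "biconnected_on E (B \<union> (set ks1 \<union> set ks2 \<union> {k}))"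
    and l: "last (b1 # ks1) \<noteq> last (b2 # ks2)" "(last (b1 # ks1), k) \<in> E" "(last (b2 # ks2), k) \<in> E"
    by (rule meeting_ear[OF finE acyc bi fB b(1,2) ne F_def k])
  have FE: "F\<^sup>+ \<subseteq> E\<^sup>+" by (auto simp: F_def intro: trancl_mono)
  have "set ks1 \<union> set ks2 \<union> {k} \<subseteq> V"
    using walk_sorted[OF s(1)] walk_sorted[OF s(2)] FE trancl_V by (auto simp: sorted_wrt_append)
  then have "k = h"
    using level1_hybrid_unique[OF level1 bic, of k h] hybridI[OF l(2,3,1)] hybrid_h BV B by auto
  then show False using out B by auto
qed

lemma hang_cover:
  assumes "k \<in> V" "k \<notin> B" shows "\<exists>b\<in>B. k \<in> hang E B b"
proof -
  have "(\<rho>, k) \<in> E\<^sup>*" using root_reaches assms by blast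
  then show ?thesis using assms(2)
  proof (induction rule: rtrancl_induct)
    case (step y z)
    show ?case
    proof (cases "y \<in> B")
      case True
      then show ?thesis using step by (intro bexI[of _ y]) (auto simp: hang_def)
    next
      case False
      then obtain b where "b \<in> B" "y \<in> hang E B b" using step by blast
      then show ?thesis using step.hyps(2) step.prems by (intro bexI[of _ b]) (auto simp: hang_def intro: trancl_into_trancl)
    qed
  qed (use B in simp)
qed

text \<open>No edge leads from a hanging part back to the cycle, by \<open>pred_B\<close>. An edge
  entering the part from elsewhere starts on the cycle or in another hanging part, so its head would
  hang off two cycle vertices, against \<open>hang_disjoint\<close>.\<close>

lemma hang_pending:
  assumes b: "b \<in> B" shows "pending E (hang E B b) b"
  unfolding pending_def
proof (intro conjI allI impI ballI)
  fix x y assume xy: "(x, y) \<in> E"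
  show "y \<in> hang E B b" if x: "x \<in> hang E B b"
  proof -
    have "y \<notin> B" using pred_B xy hang_out[OF x] by blast
    then show ?thesis using x xy by (auto simp: hang_def intro: trancl_into_trancl)
  qed
  show "x \<in> hang E B b \<or> x = b" if y: "y \<in> hang E B b"
  proof (cases "x \<in> B")
    case True
    then have "y \<in> hang E B x" using xy hang_out[OF y] by (auto simp: hang_def)
    then show ?thesis using hang_disjoint[OF b True y] by simp
  next
    case False
    then obtain b' where b': "b' \<in> B" "x \<in> hang E B b'" using hang_cover xy EV by blast
    then have "y \<in> hang E B b'" using xy hang_out[OF y] by (auto simp: hang_def intro: trancl_into_trancl)
    then show ?thesis using hang_disjoint[OF b b'(1) y] b' by simp
  qed
qed (use hang_E in \<open>auto dest: trancl_into_rtrancl\<close>)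

lemma B_no_leaf: "X \<inter> B = {}"
proof -
  have "sorted_wrt (\<lambda>x y. (x, y) \<in> E\<^sup>+) (\<rho> # ps @ [h])" "sorted_wrt (\<lambda>x y. (x, y) \<in> E\<^sup>+) (\<rho> # qs @ [h])"
    using walk_sorted s1 s2 by blast+
  then have "\<exists>y. (b, y) \<in> E\<^sup>+" if "b \<in> B" "b \<noteq> h" for b
    using that B by (auto simp: sorted_wrt_append)
  then have "\<exists>y. (b, y) \<in> E" if "b \<in> B" "b \<noteq> h" for b
    using that by (metis tranclD)
  then show ?thesis using leaf_no_succ hybrid_no_leaf[OF hybrid_h] by blast
qed

text \<open>All parents of cycle vertices are known, and this turns that knowledge around: a side
  vertex has a single child on the cycle. Stated for abstract sides \<open>rs\<close> and
  \<open>os\<close> so that it serves \<open>ps\<close> and \<open>qs\<close> alike.\<close>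

lemma side_succ:
  assumes s: "successively (\<lambda>x y. (x, y) \<in> E) (\<rho> # rs @ [h])" "successively (\<lambda>x y. (x, y) \<in> E) (\<rho> # os @ [h])"
    and B': "B = set (\<rho> # h # rs @ os)" and d: "distinct (\<rho> # h # rs @ os)"
    and i: "i < length rs" and y: "(rs ! i, y) \<in> E" "y \<in> B"
  shows "y = (rs @ [h]) ! Suc i"
proof -
  have rs: "set rs \<subseteq> B" "h \<notin> set rs" and os: "set os \<subseteq> B" "h \<notin> set os" using B' d by auto
  have r: "rs ! i \<in> set rs" using i by simp
  consider "y = h" | j where "j < length rs" "y = rs ! j" | j where "j < length os" "y = os ! j"
    using y B' no_pred_root by (auto simp: in_set_conv_nth)
  then show ?thesis
  proof cases
    case 1
    \<comment> \<open>\<open>h\<close> has exactly these two parents, and the one on the other side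
      is not in \<open>rs\<close>; hence \<open>rs ! i\<close> is the last vertex of its own
      side.\<close>
    have "{last (\<rho> # rs), last (\<rho> # os)} \<subseteq> {y. (y, h) \<in> E}"
      using s successively_append_iff[of _ "\<rho> # rs" "[h]"] successively_append_iff[of _ "\<rho> # os" "[h]"] by auto
    moreover have "last (\<rho> # rs) \<noteq> last (\<rho> # os)"
      using i d by (cases rs rule: rev_cases; cases os rule: rev_cases) auto
    ultimately have "rs ! i = last (\<rho> # rs) \<or> rs ! i = last (\<rho> # os)"
      using y 1 hybrid_preds[of "last (\<rho> # rs)" h "last (\<rho> # os)"] by auto
    moreover have "rs ! i \<noteq> last (\<rho> # os)" using r d by (cases os rule: rev_cases) auto
    ultimately have "rs ! i = rs ! (length rs - 1)" using i by (auto simp: last_conv_nth split: if_splits)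
    then have "i = length rs - 1" using i d nth_eq_iff_index_eq[of rs] by auto
    moreover have "Suc (length rs - 1) = length rs" using i by simp
    ultimately show ?thesis using 1 by (simp only: nth_append_length)
  next
    case (2 j)
    then have "rs ! i = (\<rho> # rs) ! j" using pred_side[OF s(1) rs] y by auto
    then have "j = Suc i" using 2 i d r nth_eq_iff_index_eq[of rs] by (cases j) auto
    then show ?thesis using 2 by (simp add: nth_append)
  next
    case (3 j)
    then have "rs ! i = (\<rho> # os) ! j" using pred_side[OF s(2) os] y by auto
    moreover have "(\<rho> # os) ! j \<in> set (\<rho> # os)" using 3 by (intro nth_mem) auto
    ultimately show ?thesis using r d by auto
  qed
qed

text \<open>The hybrid-vertex has a child, which cannot lie on the cycle since \<open>h\<close> is
  no parent of a cycle vertex. Any other cycle vertex below the root is neither a leaf nor hybrid,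
  so it has two children, of which \<open>side_succ\<close> allows only one on the cycle.\<close>

lemma succ_out:
  assumes "b \<in> B" "b \<noteq> \<rho>" shows "\<exists>k. (b, k) \<in> E \<and> k \<notin> B"
proof (cases "b = h")
  case True
  obtain k where k: "(h, k) \<in> E"
    using succ_unless_leaf[of h] hybrid_no_leaf[OF hybrid_h] BV B by auto
  have "k \<notin> B"
  proof
    assume kB: "k \<in> B"
    have "k \<noteq> h" using k acyc' by blast
    then have "k \<in> insert \<rho> (set ps) \<or> k \<in> insert \<rho> (set qs)" using kB B by auto
    then have "h \<in> insert \<rho> (set ps) \<or> h \<in> insert \<rho> (set qs)"
      using side_closed[OF s1 ps_B k] side_closed[OF s2 qs_B k] by blast
    then show False using dist by auto
  qed
  then show ?thesis using k True by blast
next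
  case False
  have "b \<notin> X" "b \<in> V" "\<not> hybrid E b" using False assms B_no_leaf BV hybrid_only_h by auto
  then have ts: "\<exists>y. (b, y) \<in> E \<and> y \<noteq> z" for z using two_succ by blast
  from False assms B consider i where "i < length ps" "b = ps ! i" | i where "i < length qs" "b = qs ! i"
    by (auto simp: in_set_conv_nth)
  then obtain z where "\<And>y. (b, y) \<in> E \<Longrightarrow> y \<in> B \<Longrightarrow> y = z"
  proof cases
    case (1 i)
    then show ?thesis using that side_succ[OF s1 s2 B dist] by blast
  next
    case (2 i)
    have "B = set (\<rho> # h # qs @ ps)" "distinct (\<rho> # h # qs @ ps)" using B dist by auto
    then show ?thesis using 2 that side_succ[OF s2 s1] by blast
  qed
  then show ?thesis using ts by blast
qed

lemma hang_leaf_ex: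
  assumes "b \<in> B" "b \<noteq> \<rho>" shows "X \<inter> hang E B b \<noteq> {}"
proof -
  obtain k where k: "(b, k) \<in> E" "k \<notin> B" using succ_out[OF assms] by blast
  then have kh: "k \<in> hang E B b" by (auto simp: hang_def)
  obtain x where "x \<in> X" "(k, x) \<in> E\<^sup>*" using leaf_below k EV by blast
  then show ?thesis using pending_down[OF hang_pending[OF assms(1)] _ kh] by blast
qed

lemma hang_not_all:
  assumes "b \<in> B" shows "\<not> X \<subseteq> hang E B b"
proof
  assume a: "X \<subseteq> hang E B b"
  \<comment> \<open>As the sides are not both empty, \<open>h\<close> and a side vertex are two
    different non-root vertices of the cycle; one of them differs from \<open>b\<close> and has a
    leaf of its own.\<close>
  have "\<exists>b'. b' \<in> B \<and> b' \<noteq> \<rho> \<and> b' \<noteq> b" using ne dist B by (cases ps; cases qs; cases "b = h") auto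
  then obtain b' where b': "b' \<in> B" "b' \<noteq> \<rho>" "b' \<noteq> b" by blast
  then show False using hang_leaf_ex[OF b'(1,2)] hang_disjoint[OF assms b'(1)] a by blast
qed

text \<open>Determined only at cycle vertices other than the root, where the intersection turns out
  to be a singleton.\<close>

definition leaf_at :: "'a \<Rightarrow> 'a" where "leaf_at b = (SOME x. X \<inter> hang E B b = {x})"

lemma leaf_at: assumes "b \<in> B" "b \<noteq> \<rho>" shows "X \<inter> hang E B b = {leaf_at b}"
proof -
  have "\<exists>x. X \<inter> hang E B b = {x}"
    using pending_leaves[OF hang_pending[OF assms(1)]] hang_leaf_ex[OF assms] hang_not_all[OF assms(1)] by blast
  then show ?thesis unfolding leaf_at_def by (rule someI_ex)
qed

lemma hang_root: "X \<inter> hang E B \<rho> = {}"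
proof -
  have "\<rho> \<in> B" using B by simp
  then show ?thesis
    using pending_root[OF hang_pending _ hang_V] hang_not_all hang_out by blast
qed

lemma leaves: "X = leaf_at ` (B - {\<rho>})"
proof
  show "X \<subseteq> leaf_at ` (B - {\<rho>})"
  proof
    fix x assume x: "x \<in> X"
    then have "x \<in> V" "x \<notin> B" using XV B_no_leaf by auto
    then obtain b where b: "b \<in> B" "x \<in> hang E B b" using hang_cover by blast
    then have "b \<noteq> \<rho>" using hang_root x by blast
    then show "x \<in> leaf_at ` (B - {\<rho>})" using leaf_at[OF b(1)] b x by blast
  qed
  show "leaf_at ` (B - {\<rho>}) \<subseteq> X" using leaf_at by blast
qed

lemma inj_leaf: "inj_on leaf_at (B - {\<rho>})"
proof (rule inj_onI)
  fix b b' assume b: "b \<in> B - {\<rho>}" "b' \<in> B - {\<rho>}" "leaf_at b = leaf_at b'"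
  then have "leaf_at b \<in> hang E B b" "leaf_at b \<in> hang E B b'" using leaf_at[of b] leaf_at[of b'] by auto
  then show "b = b'" using hang_disjoint b by blast
qed

lemma leaf_anc:
  assumes "b \<in> B" "b \<noteq> \<rho>" shows "(w, leaf_at b) \<in> E\<^sup>* \<Longrightarrow> w \<in> hang E B b \<or> (w, b) \<in> E\<^sup>*"
    and "(b, leaf_at b) \<in> E\<^sup>*"
proof -
  have l: "leaf_at b \<in> hang E B b" using leaf_at[OF assms] by blast
  show "(w, leaf_at b) \<in> E\<^sup>* \<Longrightarrow> w \<in> hang E B b \<or> (w, b) \<in> E\<^sup>*"
    using pending_up[OF hang_pending[OF assms(1)]] l by blast
  show "(b, leaf_at b) \<in> E\<^sup>*" using hang_E[OF l] by auto
qed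

text \<open>A common ancestor inside the part at \<open>b\<close> would be off the cycle. It could
  then be neither above \<open>b'\<close>, since ancestors of cycle vertices are on the cycle, nor
  in the part at \<open>b'\<close>, which is disjoint from the part at \<open>b\<close>.\<close>

lemma common_anc:
  assumes b: "b \<in> B" "b \<noteq> \<rho>" "b' \<in> B" "b' \<noteq> \<rho>" "b \<noteq> b'"
    and w: "(w, leaf_at b) \<in> E\<^sup>*" "(w, leaf_at b') \<in> E\<^sup>*"
  shows "(w, b) \<in> E\<^sup>*" "(w, b') \<in> E\<^sup>*"
  using leaf_anc(1)[OF b(1,2) w(1)] leaf_anc(1)[OF b(3,4) w(2)] hang_disjoint[OF b(1,3)] b(5)
    anc_B[of w b] anc_B[of w b'] b hang_out by blast+

text \<open>By \<open>common_anc\<close> it suffices to look at common ancestors of two cycle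
  vertices, and on one side the earlier vertex lies above the later one. Appending \<open>h\<close>
  makes its leaf the last one of either side.\<close>

lemma lca_side:
  assumes s: "successively (\<lambda>x y. (x, y) \<in> E) (\<rho> # rs @ [h])" and rs: "set rs \<subseteq> B"
    and d: "distinct (\<rho> # rs @ [h])" and ij: "i < j" "j < length (rs @ [h])"
  shows "lca E (leaf_at ((rs @ [h]) ! i)) (leaf_at ((rs @ [h]) ! j)) = rs ! i"
proof (rule lca_eqI[OF acyc])
  let ?b = "(rs @ [h]) ! i" and ?b' = "(rs @ [h]) ! j"
  have bi: "?b = rs ! i" using ij by (simp add: nth_append)
  have mem: "?b \<in> set (rs @ [h])" "?b' \<in> set (rs @ [h])" using ij by (intro nth_mem; simp)+
  then have m: "?b \<in> B" "?b \<noteq> \<rho>" "?b' \<in> B" "?b' \<noteq> \<rho>" using rs d B by auto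
  have nb: "?b \<noteq> ?b'" using ij d nth_eq_iff_index_eq[of "rs @ [h]" i j] by auto
  have "sorted_wrt (\<lambda>x y. (x, y) \<in> E\<^sup>+) (rs @ [h])" using walk_sorted[OF s] by simp
  then have "(?b, ?b') \<in> E\<^sup>+" using ij by (simp add: sorted_wrt_iff_nth_less)
  then show "(rs ! i, leaf_at ?b') \<in> E\<^sup>*"
    using leaf_anc(2)[OF m(3,4)] bi by (metis rtrancl_trans trancl_into_rtrancl)
  show "(rs ! i, leaf_at ?b) \<in> E\<^sup>*" using leaf_anc(2)[OF m(1,2)] bi by simp
  show "(w, rs ! i) \<in> E\<^sup>*" if "(w, leaf_at ?b) \<in> E\<^sup>*" "(w, leaf_at ?b') \<in> E\<^sup>*" for w
    using common_anc(1)[OF m nb that] bi by simp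
qed

text \<open>\<open>side_anc\<close> confines the ancestors of a side vertex to its own side and the
  root, and the sides are disjoint.\<close>

lemma lca_across:
  assumes p: "p \<in> set ps" and q: "q \<in> set qs"
  shows "lca E (leaf_at p) (leaf_at q) = \<rho>"
proof (rule lca_eqI[OF acyc])
  have m: "p \<in> B" "p \<noteq> \<rho>" "q \<in> B" "q \<noteq> \<rho>" and nb: "p \<noteq> q" using p q dist B by auto
  have "leaf_at p \<in> V" "leaf_at q \<in> V" using leaves XV m by auto
  then show "(\<rho>, leaf_at p) \<in> E\<^sup>*" "(\<rho>, leaf_at q) \<in> E\<^sup>*" using root_reaches by auto
  show "(w, \<rho>) \<in> E\<^sup>*" if "(w, leaf_at p) \<in> E\<^sup>*" "(w, leaf_at q) \<in> E\<^sup>*" for w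
  proof -
    have "w \<in> insert \<rho> (set ps)" "w \<in> insert \<rho> (set qs)"
      using common_anc[OF m nb that] side_anc[OF s1 ps_B] side_anc[OF s2 qs_B] p q by blast+
    then show ?thesis using dist by auto
  qed
qed

lemma staged_side:
  assumes s: "successively (\<lambda>x y. (x, y) \<in> E) (\<rho> # rs @ [h])" and rs: "set rs \<subseteq> B"
    and d: "distinct (\<rho> # rs @ [h])"
  shows "staged (gE G) (\<lambda>i. t (rs ! i) = Lab1) (map (\<lambda>b. \<phi> (leaf_at b)) (rs @ [h]))"
  unfolding staged_def
proof (intro allI impI)
  fix i j assume ij: "i < j" "j < length (map (\<lambda>b. \<phi> (leaf_at b)) (rs @ [h]))"
  let ?b = "(rs @ [h]) ! i" and ?b' = "(rs @ [h]) ! j"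
  have mem: "?b \<in> set (rs @ [h])" "?b' \<in> set (rs @ [h])" using ij by (intro nth_mem; simp)+
  then have m: "?b \<in> B - {\<rho>}" "?b' \<in> B - {\<rho>}" using rs d B by auto
  have nb: "?b \<noteq> ?b'" using ij d nth_eq_iff_index_eq[of "rs @ [h]" i j] by auto
  then have "leaf_at ?b \<noteq> leaf_at ?b'" using inj_leaf m by (auto simp: inj_on_def)
  moreover have "leaf_at ?b \<in> X" "leaf_at ?b' \<in> X" using leaves m by auto
  ultimately have "(\<phi> (leaf_at ?b), \<phi> (leaf_at ?b')) \<in> gE G \<longleftrightarrow> t (rs ! i) = Lab1"
    using adj lca_side[OF s rs d ij(1)] ij(2) by simp
  then show "(map (\<lambda>b. \<phi> (leaf_at b)) (rs @ [h]) ! i, map (\<lambda>b. \<phi> (leaf_at b)) (rs @ [h]) ! j) \<in> gE G \<longleftrightarrow> t (rs ! i) = Lab1"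
    using ij by (simp del: map_append)
qed

text \<open>The normal form before primitivity is used on it: \<open>f\<close>, \<open>g\<close> and
  \<open>c\<close> record where the labels are 1, with no alternation yet, and one list may still be
  empty. The leaf at \<open>h\<close> becomes \<open>v\<close>, as it lies below both sides.\<close>

lemma cycle_lists:
  "\<exists>v xs ys f g c. xs @ ys \<noteq> [] \<and> distinct (v # xs @ ys) \<and> gV G = set (v # xs @ ys) \<and>
     staged (gE G) f (xs @ [v]) \<and> staged (gE G) g (ys @ [v]) \<and>
     (\<forall>x\<in>set xs. \<forall>y\<in>set ys. (x, y) \<in> gE G \<longleftrightarrow> c)"
proof -
  let ?l = "\<lambda>b. \<phi> (leaf_at b)"
  have B': "B - {\<rho>} = set (h # ps @ qs)" using B dist by auto
  have inj: "inj_on ?l (B - {\<rho>})"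
    using comp_inj_on[OF inj_leaf, of \<phi>] bij leaves by (simp add: bij_betw_def comp_def)
  have img: "gV G = ?l ` (B - {\<rho>})" using bij leaves by (metis bij_betw_imp_surj_on image_image)
  have d: "distinct (map ?l (h # ps @ qs))"
    unfolding distinct_map using inj dist B' by simp
  have cr: "(?l p, ?l q) \<in> gE G \<longleftrightarrow> t \<rho> = Lab1" if "p \<in> set ps" "q \<in> set qs" for p q
  proof -
    have m: "p \<in> B - {\<rho>}" "q \<in> B - {\<rho>}" "p \<noteq> q" using that dist B by auto
    then have "leaf_at p \<noteq> leaf_at q" using inj_leaf by (auto simp: inj_on_def)
    then show ?thesis using adj[of "leaf_at p" "leaf_at q"] leaves m lca_across[OF that] by auto
  qed
  show ?thesis
  proof (intro exI conjI ballI)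
    show "map ?l ps @ map ?l qs \<noteq> []" using ne by simp
    show "distinct (?l h # map ?l ps @ map ?l qs)" using d by simp
    show "gV G = set (?l h # map ?l ps @ map ?l qs)" unfolding img B' by auto
    show "staged (gE G) (\<lambda>i. t (ps ! i) = Lab1) (map ?l ps @ [?l h])"
      using staged_side[OF s1 ps_B(1)] dist by simp
    show "staged (gE G) (\<lambda>i. t (qs ! i) = Lab1) (map ?l qs @ [?l h])"
      using staged_side[OF s2 qs_B(1)] dist by simp
    fix x y assume "x \<in> set (map ?l ps)" "y \<in> set (map ?l qs)"
    then show "(x, y) \<in> gE G \<longleftrightarrow> t \<rho> = Lab1" using cr by auto
  qed
qed

end

section \<open>Primitivity forces alternating labels\<close>

lemma primitive_no_universal:
  assumes G: "is_graph G" and P: "primitive G" and z: "z \<in> gV G"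
    and u: "\<And>x. x \<in> gV G \<Longrightarrow> x \<noteq> z \<Longrightarrow> (z, x) \<in> gE G \<longleftrightarrow> e"
  shows False
proof -
  have s: "(x, z) \<in> gE G \<longleftrightarrow> e" if "x \<in> gV G - {z}" for x using u[of x] that is_graph_sym[OF G, of x z] by auto
  have sub: "nbhd G x \<subseteq> gV G" for x using G by (auto simp: nbhd_def is_graph_def)
  have "nbhd G x - (gV G - {z}) = (if e then {z} else {})" if "x \<in> gV G - {z}" for x
    using s[OF that] sub[of x] by (auto simp: nbhd_def)
  \<comment> \<open>The only vertex outside this set is \<open>z\<close>, and all others agree about
    it.\<close>
  then have "is_module G (gV G - {z})" unfolding is_module_def by auto
  then have "gV G - {z} = {} \<or> gV G - {z} = gV G \<or> (\<exists>x. gV G - {z} = {x})"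
    using P unfolding primitive_def by blast
  moreover have "gV G - {z} \<noteq> gV G" using z by blast
  ultimately have "card (gV G - {z}) \<le> 1" by (metis One_nat_def card.empty card_1_singleton_iff le_simps(1) order_refl zero_less_one)
  then have "card (gV G) \<le> 2" using z by (simp add: card_Diff_singleton)
  then show False using P by (simp add: primitive_def)
qed

lemma primitive_no_twins:
  assumes G: "is_graph G" and P: "primitive G" and xy: "x \<in> gV G" "y \<in> gV G" "x \<noteq> y"
    and u: "\<And>z. z \<in> gV G \<Longrightarrow> z \<noteq> x \<Longrightarrow> z \<noteq> y \<Longrightarrow> (z, x) \<in> gE G \<longleftrightarrow> (z, y) \<in> gE G"
  shows False
proof -
  have sub: "nbhd G x \<subseteq> gV G" for x using G by (auto simp: nbhd_def is_graph_def)
  have "z \<in> nbhd G x \<longleftrightarrow> z \<in> nbhd G y" if "z \<noteq> x" "z \<noteq> y" for z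
    using u[of z] that sub[of x] sub[of y] is_graph_sym[OF G, of z x] is_graph_sym[OF G, of z y]
    by (auto simp: nbhd_def)
  then have "nbhd G x - {x, y} = nbhd G y - {x, y}" by blast
  then have "is_module G {x, y}" unfolding is_module_def using xy by auto
  then have "{x, y} = gV G" using P xy unfolding primitive_def by blast
  then have "card (gV G) = 2" using xy by (metis card_2_iff)
  then show False using P by (simp add: primitive_def)
qed

text \<open>If the first label equalled \<open>c\<close>, the vertex \<open>xs ! 0\<close> would see
  all others alike. If two consecutive labels were equal, their vertices would be twins: earlier
  list elements never separate them, later ones and \<open>v\<close> see them with equal labels, and
  \<open>ys\<close> sees both with value \<open>c\<close>.\<close>

lemma primitive_alternates:
  assumes G: "is_graph G" and P: "primitive G" and d: "distinct (v # xs @ ys)" and V: "gV G = set (v # xs @ ys)"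
    and sx: "staged (gE G) f (xs @ [v])" and cr: "\<And>x y. x \<in> set xs \<Longrightarrow> y \<in> set ys \<Longrightarrow> (x, y) \<in> gE G \<longleftrightarrow> c"
    and i: "i < length xs"
  shows "f i \<longleftrightarrow> even i = (\<not> c)"
  using i
proof (induction i)
  case 0
  have x0: "xs ! 0 \<in> set xs" using 0 by simp
  show ?case
  proof (rule ccontr)
    assume "\<not> ?thesis"
    then have f: "f 0 = c" by auto
    show False
    proof (rule primitive_no_universal[OF G P, of "xs ! 0" c])
      fix x assume "x \<in> gV G" "x \<noteq> xs ! 0"
      then show "(xs ! 0, x) \<in> gE G \<longleftrightarrow> c"
        using staged_first[OF sx, of x] f 0 V cr[OF x0] by auto
    qed (use V x0 in simp)
  qed
next
  case (Suc i)
  note X = staged_snocD[OF sx]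
  have "f (Suc i) \<noteq> f i"
  proof
    assume f: "f (Suc i) = f i"
    have m: "xs ! i \<in> set xs" "xs ! Suc i \<in> set xs" using Suc by auto
    show False
    proof (rule primitive_no_twins[OF G P, of "xs ! i" "xs ! Suc i"])
      show "xs ! i \<noteq> xs ! Suc i" using d Suc.prems by (simp add: nth_eq_iff_index_eq)
      fix z assume z: "z \<in> gV G" "z \<noteq> xs ! i" "z \<noteq> xs ! Suc i"
      then consider "z = v" | j where "j < length xs" "z = xs ! j" | "z \<in> set ys"
        using V by (auto simp: in_set_conv_nth)
      then show "(z, xs ! i) \<in> gE G \<longleftrightarrow> (z, xs ! Suc i) \<in> gE G"
      proof cases
        case (2 j)
        then have "j \<noteq> i" "j \<noteq> Suc i" using z by auto
        then consider "j < i" | "j > Suc i" by linarith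
        then show ?thesis
        proof cases
          case 1
          then show ?thesis using X(1)[of j i] X(1)[of j "Suc i"] 2 Suc.prems by simp
        next
          case j: 2
          then show ?thesis using X(1)[of i j] X(1)[of "Suc i" j] 2 f
              is_graph_sym[OF G, of z "xs ! i"] is_graph_sym[OF G, of z "xs ! Suc i"] by simp
        qed
      next
        case 1
        then show ?thesis using X(2)[of i] X(2)[of "Suc i"] Suc.prems f
            is_graph_sym[OF G, of z "xs ! i"] is_graph_sym[OF G, of z "xs ! Suc i"] by simp
      next
        case 3
        then show ?thesis using cr[OF m(1)] cr[OF m(2)]
            is_graph_sym[OF G, of z "xs ! i"] is_graph_sym[OF G, of z "xs ! Suc i"] by simp
      qed
    qed (use V m in auto)
  qed
  then show ?case using Suc by auto
qed

lemma staged_cong: "(\<And>i. i < length xs \<Longrightarrow> f i = g i) \<Longrightarrow> staged R f (xs @ [v]) \<Longrightarrow> staged R g (xs @ [v])"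
  unfolding staged_def by simp

text \<open>Excludes a cycle with an empty side, where the first vertex of the only list would see
  all others alike.\<close>

lemma primitive_not_one_sided:
  assumes G: "is_graph G" and P: "primitive G" and V: "gV G = set (xs @ [v])"
    and ne: "xs \<noteq> []" and s: "staged (gE G) f (xs @ [v])"
  shows False
  by (rule primitive_no_universal[OF G P, of "xs ! 0" "f 0"]) (use V ne staged_first[OF s ne] in auto)

lemma explainable_polar_lists:
  assumes G: "is_graph G" and P: "primitive G" and L: "level1_explainable G"
  shows "\<exists>b v xs ys. polar_lists G b v xs ys"
proof -
  obtain V E X t \<phi> where N: "level1_network (V :: ('a + nat) set) E X" and ex: "explains_via E X t \<phi> G"
    using L by (auto simp: level1_explainable_def)
  have N': "is_network V E X" using N by (simp add: level1_network_def)
  have "card X = card (gV G)" using ex by (auto simp: explains_via_def dest: bij_betw_same_card)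
  then have "card X \<noteq> 1" using P by (simp add: primitive_def)
  then obtain \<rho> where "rooted_network V E X \<rho>" using network_rooted[OF N'] by blast
  then interpret rooted_network V E X \<rho> .
  interpret explained V E X \<rho> t \<phi> G by unfold_locales (fact G P ex N)+
  obtain ps qs h where c: "successively (\<lambda>x y. (x, y) \<in> E) (\<rho> # ps @ [h])"
    "successively (\<lambda>x y. (x, y) \<in> E) (\<rho> # qs @ [h])" "ps @ qs \<noteq> []" "distinct (\<rho> # h # ps @ qs)"
    "biconnected_on E (set (\<rho> # h # ps @ qs))" using cycle_exists by blast
  interpret cycle_network V E X \<rho> t \<phi> G ps qs h "set (\<rho> # h # ps @ qs)"
    by unfold_locales (fact c refl)+
  obtain v xs ys f g c where l: "xs @ ys \<noteq> []" "distinct (v # xs @ ys)" "gV G = set (v # xs @ ys)"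
     "staged (gE G) f (xs @ [v])" "staged (gE G) g (ys @ [v])"
     "\<And>x y. x\<in>set xs \<Longrightarrow> y\<in>set ys \<Longrightarrow> (x, y) \<in> gE G \<longleftrightarrow> c"
    using cycle_lists by blast
  have l': "distinct (v # ys @ xs)" "gV G = set (v # ys @ xs)"
    using l(2,3) by auto
  have cr': "(x, y) \<in> gE G \<longleftrightarrow> c" if "x \<in> set ys" "y \<in> set xs" for x y
    using l(6)[OF that(2,1)] is_graph_sym[OF G, of x y] by simp
  have ne: "xs \<noteq> []" "ys \<noteq> []"
    using primitive_not_one_sided[OF G P, of xs v f] primitive_not_one_sided[OF G P, of ys v g] l by auto
  have "card (gV G) \<ge> 4" using P by (simp add: primitive_def)
  then have len: "length xs + length ys \<ge> 3" unfolding l(3) using distinct_card[OF l(2)] by simp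
  \<comment> \<open>Both first labels are opposite to that of the root, which fixes the parameter of
    the normal form as \<open>\<not> c\<close>.\<close>
  have "staged (gE G) (\<lambda>i. even i = (\<not> c)) (xs @ [v])"
    by (rule staged_cong[OF _ l(4)]) (rule primitive_alternates[OF G P l(2-4,6)])
  moreover have "staged (gE G) (\<lambda>i. even i = (\<not> c)) (ys @ [v])"
    by (rule staged_cong[OF _ l(5)]) (rule primitive_alternates[OF G P l' l(5) cr'])
  ultimately have "polar_lists G (\<not> c) v xs ys" unfolding polar_lists_def using ne len l by simp
  then show ?thesis by blast
qed

section \<open>Caterpillars\<close>

lemma chain_reaches:
  assumes "\<And>i. Suc i < n \<Longrightarrow> (q i, q (Suc i)) \<in> E" "i \<le> j" "j < n" shows "(q i, q j) \<in> E\<^sup>*"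
  using assms(2,3)
proof (induction j)
  case (Suc j)
  then show ?case using assms(1)[of j] by (cases "i = Suc j") (auto intro: rtrancl_into_rtrancl)
qed simp

lemma lca_pendant_leaf:
  assumes "acyclic E" "\<And>w. (w, x) \<in> E \<longleftrightarrow> w = u" "\<And>w. (x, w) \<notin> E" "(u, y) \<in> E\<^sup>*" "x \<noteq> y"
  shows "lca E x y = u"
proof (rule lca_eqI[OF assms(1)])
  show "(u, x) \<in> E\<^sup>*" using assms(2) by auto
  fix w assume w: "(w, x) \<in> E\<^sup>*" "(w, y) \<in> E\<^sup>*"
  have "w \<noteq> x"
  proof
    assume "w = x"
    then show False using w(2) assms(3,5) by (auto elim: converse_rtranclE)
  qed
  then show "(w, u) \<in> E\<^sup>*" using w(1) assms(2) by (auto elim: rtranclE)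
qed (fact assms)

text \<open>Shared by caterpillars and the cyclic network: \<open>L v\<close> need only be reachable
  from the last spine vertex, because in the network the hybrid-vertex lies in between. An earlier
  leaf hangs directly at its spine vertex, so \<open>lca_pendant_leaf\<close> applies.\<close>

lemma lca_on_spine:
  fixes L :: "'a \<Rightarrow> 'v"
  assumes "acyclic E" and spine: "\<And>i. Suc i < length xs \<Longrightarrow> (q i, q (Suc i)) \<in> E"
    and pred: "\<And>i w. i < length xs \<Longrightarrow> (w, L (xs ! i)) \<in> E \<longleftrightarrow> w = q i"
    and leaf: "\<And>i w. i < length xs \<Longrightarrow> (L (xs ! i), w) \<notin> E"
    and v: "(q (length xs - 1), L v) \<in> E\<^sup>*"
    and L: "inj L" "distinct (xs @ [v])" and ij: "i < j" "j < length (xs @ [v])"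
  shows "lca E (L ((xs @ [v]) ! i)) (L ((xs @ [v]) ! j)) = q i"
proof -
  have i: "i < length xs" "(xs @ [v]) ! i = xs ! i" using ij by (auto simp: nth_append)
  have "(q i, L ((xs @ [v]) ! j)) \<in> E\<^sup>*"
  proof (cases "j < length xs")
    case True
    then have "(q i, q j) \<in> E\<^sup>*" using chain_reaches[of "length xs" q E i j] spine ij by auto
    moreover have "(q j, L (xs ! j)) \<in> E" using pred True by auto
    ultimately show ?thesis using True by (simp add: nth_append)
  next
    case False
    then have "(q i, q (length xs - 1)) \<in> E\<^sup>*"
      using chain_reaches[of "length xs" q E i "length xs - 1"] spine i by auto
    then show ?thesis using v ij False by (auto simp: nth_append)
  qed
  moreover have "L (xs ! i) \<noteq> L ((xs @ [v]) ! j)"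
    using L ij i nth_eq_iff_index_eq[of "xs @ [v]" i j] by (auto simp: inj_eq)
  ultimately show ?thesis unfolding i(2)
    by (intro lca_pendant_leaf[OF assms(1) pred[OF i(1)] leaf[OF i(1)]])
qed

text \<open>\<open>staged\<close> describes pairs in list order only; symmetry of \<open>R\<close>
  and of \<open>lca\<close> supplies the other order.\<close>

lemma staged_adjacency:
  assumes R: "sym R" "staged R f zs" and t: "\<And>i j. i < j \<Longrightarrow> j < length zs \<Longrightarrow> t (lca E (L (zs ! i)) (L (zs ! j))) = Lab1 \<longleftrightarrow> f i"
    and xy: "x \<in> set zs" "y \<in> set zs" "x \<noteq> y"
  shows "(x, y) \<in> R \<longleftrightarrow> t (lca E (L x) (L y)) = Lab1"
proof -
  obtain i j where ij: "i < length zs" "x = zs ! i" "j < length zs" "y = zs ! j" using xy by (auto simp: in_set_conv_nth)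
  have s: "(x, y) \<in> R \<longleftrightarrow> (y, x) \<in> R" using R(1) by (auto simp: sym_def)
  consider "i < j" | "j < i" using ij xy by (cases i j rule: linorder_cases) auto
  then show ?thesis
  proof cases
    case 1 then show ?thesis using stagedD[OF R(2), of i j] t[of i j] ij by simp
  next
    case 2 then show ?thesis using stagedD[OF R(2), of j i] t[of j i] ij s lca_commute[of E "L x"] by simp
  qed
qed

text \<open>The first vertex is adjacent to all others if \<open>b\<close> holds and isolated
  otherwise. This ties \<open>b\<close> to the two alternatives in the definition of a
  polar-cat.\<close>

lemma staged_connected:
  assumes H: "is_graph H" and V: "gV H = set (xs @ [v])" and d: "distinct (xs @ [v])" "xs \<noteq> []"
    and s: "staged (gE H) (\<lambda>i. even i = b) (xs @ [v])"
  shows "connected_graph H \<longleftrightarrow> b"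
proof
  have f: "(xs ! 0, x) \<in> gE H \<longleftrightarrow> b" if "x \<in> gV H" "x \<noteq> xs ! 0" for x
    using staged_first[OF s d(2)] that V by simp
  show b if c: "connected_graph H"
  proof (rule ccontr)
    assume "\<not> b"
    then have n: "(xs ! 0, x) \<notin> gE H" for x
      using f[of x] H unfolding is_graph_def irrefl_def by blast
    have "xs ! 0 \<in> gV H" "v \<in> gV H" using V d(2) by auto
    then have "(xs ! 0, v) \<in> (gE H)\<^sup>*" using c by (simp add: connected_graph_def)
    then have "xs ! 0 = v" using n by (auto elim: converse_rtranclE)
    then show False using d by (metis distinct_append in_set_conv_nth length_greater_0_conv disjoint_iff list.set_intros(1))
  qed
  show "connected_graph H" if b
  proof -
    have "(xs ! 0, x) \<in> (gE H)\<^sup>*" "(x, xs ! 0) \<in> (gE H)\<^sup>*" if "x \<in> gV H" for x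
      using f[OF that] \<open>b\<close> is_graph_sym[OF H, of x "xs ! 0"] by (cases "x = xs ! 0"; auto)+
    then have "(x, y) \<in> (gE H)\<^sup>*" if "x \<in> gV H" "y \<in> gV H" for x y using that by (meson rtrancl_trans)
    then show ?thesis using V by (auto simp: connected_graph_def)
  qed
qed

text \<open>Of the four vertices of an induced path, the earliest in the list would be adjacent to
  all or to none of the other three, but every vertex of such a path has a neighbour and a
  non-neighbour in it.\<close>

lemma staged_cograph:
  assumes H: "is_graph H" and V: "gV H = set zs" and s: "staged (gE H) f zs"
  shows "is_cograph H"
  unfolding is_cograph_def
proof (intro notI, elim exE conjE)
  fix a b c d
  assume dis: "distinct [a, b, c, d]" and sub: "{a, b, c, d} \<subseteq> gV H"
    and e: "(a, b) \<in> gE H" "(b, c) \<in> gE H" "(c, d) \<in> gE H" "(a, c) \<notin> gE H" "(b, d) \<notin> gE H" "(a, d) \<notin> gE H"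
  have e': "(b, a) \<in> gE H" "(d, c) \<in> gE H" "(c, a) \<notin> gE H" "(d, a) \<notin> gE H" using e is_graph_sym[OF H] by blast+
  obtain i j k l where ix: "i < length zs" "a = zs ! i" "j < length zs" "b = zs ! j"
    "k < length zs" "c = zs ! k" "l < length zs" "d = zs ! l"
    using sub V by (auto simp: in_set_conv_nth)
  then have "i \<noteq> j" "i \<noteq> k" "i \<noteq> l" "j \<noteq> k" "j \<noteq> l" "k \<noteq> l" using dis by auto
  then consider "i < j" "i < k" | "j < i" "j < l" | "k < i" "k < l" | "l < i" "l < k" by linarith
  then show False
    by cases (use stagedD[OF s, of i j] stagedD[OF s, of i k] stagedD[OF s, of j i] stagedD[OF s, of j l]
      stagedD[OF s, of k i] stagedD[OF s, of k l] stagedD[OF s, of l i] stagedD[OF s, of l k] ix e e' in simp)+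
qed

text \<open>The list collects one leaf child per spine vertex from the root downwards. The cherry
  puts \<open>v\<close> at the lower end, and discriminating labels alternate because inner vertices
  have only two possible labels.\<close>

lemma caterpillar_lists:
  assumes "cat_explainable_cherry H v"
  shows "\<exists>xs b. xs \<noteq> [] \<and> distinct (xs @ [v]) \<and> gV H = set (xs @ [v]) \<and>
     staged (gE H) (\<lambda>i. even i = b) (xs @ [v])"
proof -
  define X where "X = (Inl ` gV H :: ('a + nat) set)"
  obtain V :: "('a + nat) set" and E t where ct: "cotree_of H V E t" and disc: "discriminating E X t"
    and cat: "caterpillar V E X" and ch: "in_cherry E X (Inl v)"
    using assms unfolding cat_explainable_cherry_def X_def by blast
  obtain ps where ps: "ps \<noteq> []" "distinct ps" "set ps = V - X"
    and spine: "E \<inter> ((V - X) \<times> (V - X)) = set (zip ps (tl ps))"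
    using cat by (auto simp: caterpillar_def)
  have N: "is_network V E X" and lab: "\<And>u. u \<in> V \<Longrightarrow> t u = LabOdot \<longleftrightarrow> u \<in> X"
    and adj: "\<And>x y. x \<in> gV H \<Longrightarrow> y \<in> gV H \<Longrightarrow> x \<noteq> y \<Longrightarrow> (x, y) \<in> gE H \<longleftrightarrow> t (lca E (Inl x) (Inl y)) = Lab1"
    using ct by (auto simp: cotree_of_def labeled_network_def X_def)
  have out2: "\<And>u. u \<in> V - X \<Longrightarrow> outdeg E u = 2" using cat by (auto simp: caterpillar_def)
  have EV: "E \<subseteq> V \<times> V" and acyc: "acyclic E" and XV: "X \<subseteq> V" and finV: "finite V" using N by (auto simp: is_network_def)
  have fin: "finite {w. (u, w) \<in> E}" for u using EV finV by (auto intro: finite_subset[of _ V])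
  have "V - X \<noteq> {}" using ps(1,3) by (metis set_empty)
  then have leafX: "\<And>x. x \<in> X \<Longrightarrow> outdeg E x = 0 \<and> indeg E x = 1"
    using N unfolding is_network_def by blast
  then have leaf_out: "(x, w) \<notin> E" if "x \<in> X" for x w using leafX[OF that] fin[of x] by (auto simp: outdeg_def)
  have leaf_pred: "\<exists>u. \<forall>w. (w, x) \<in> E \<longleftrightarrow> w = u" if "x \<in> X" for x
    using leafX[OF that] by (auto simp: indeg_def card_1_singleton_iff set_eq_iff)
  have inner: "i < length ps \<Longrightarrow> ps ! i \<in> V - X" for i using ps nth_mem by blast
  have next_edge: "(ps ! i, ps ! Suc i) \<in> E" if "Suc i < length ps" for i
  proof -
    have "(ps ! i, ps ! Suc i) \<in> set (zip ps (tl ps))"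
      using that by (auto simp: in_set_zip nth_tl intro!: exI[of _ i])
    then show ?thesis using spine by blast
  qed
  have inner_succ: "Suc i < length ps \<and> w = ps ! Suc i" if e: "(ps ! i, w) \<in> E" "w \<notin> X" and i: "i < length ps" for i w
  proof -
    have "(ps ! i, w) \<in> set (zip ps (tl ps))" using e inner[OF i] EV spine by blast
    then obtain k where "k < length ps - 1" "ps ! k = ps ! i" "w = ps ! Suc k"
      by (auto simp: in_set_zip nth_tl)
    then show ?thesis using ps(2) i nth_eq_iff_index_eq[of ps k i] by auto
  qed
  have succ2: "\<exists>y z. y \<noteq> z \<and> {w. (ps ! i, w) \<in> E} = {y, z}" if "i < length ps" for i
    using out2[OF inner[OF that]] by (auto simp: outdeg_def card_2_iff)
  obtain p l' where vX: "Inl v \<in> X" and l': "l' \<in> X" "l' \<noteq> Inl v" "(p, Inl v) \<in> E" "(p, l') \<in> E"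
    using ch by (auto simp: in_cherry_def)
  have "p \<in> V - X" using l' EV leaf_out by blast
  then obtain k where k: "k < length ps" "p = ps ! k" using ps by (metis in_set_conv_nth)
  \<comment> \<open>The parent \<open>p\<close> of the cherry is the last spine vertex: a further
    spine vertex would be its third child.\<close>
  have last: "\<not> Suc k < length ps"
  proof
    assume s: "Suc k < length ps"
    then have "ps ! Suc k \<notin> X" using inner by blast
    moreover have "(p, ps ! Suc k) \<in> E" using next_edge[OF s] k by simp
    moreover have "ps ! Suc k \<noteq> Inl v" "ps ! Suc k \<noteq> l'" using \<open>ps ! Suc k \<notin> X\<close> l'(1) vX by metis+
    ultimately have "{ps ! Suc k, Inl v, l'} \<subseteq> {w. (p, w) \<in> E}" "card {ps ! Suc k, Inl v, l'} = 3"
      using l' by auto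
    then have "3 \<le> outdeg E p" unfolding outdeg_def using card_mono[OF fin[of p]] by metis
    then show False using out2 \<open>p \<in> V - X\<close> by simp
  qed
  have "\<exists>x. x \<in> gV H \<and> x \<noteq> v \<and> {w. (ps ! i, w) \<in> E} = {Inl x, if Suc i < length ps then ps ! Suc i else Inl v}"
    if i: "i < length ps" for i
  proof (cases "Suc i < length ps")
    case True
    obtain y z where yz: "y \<noteq> z" "{w. (ps ! i, w) \<in> E} = {y, z}" using succ2[OF i] by blast
    have s: "ps ! Suc i \<in> {y, z}" using next_edge[OF True] yz by auto
    then obtain x where x: "x \<noteq> ps ! Suc i" "{w. (ps ! i, w) \<in> E} = {x, ps ! Suc i}"
      using yz by (metis doubleton_eq_iff empty_iff insert_iff)
    then have e: "(ps ! i, x) \<in> E" by auto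
    then have "x \<in> X" using inner_succ[OF e] x i by auto
    then obtain a where a: "a \<in> gV H" "x = Inl a" by (auto simp: X_def)
    \<comment> \<open>The only parent of \<open>v\<close> is the last spine vertex, whereas
      \<open>ps ! i\<close> has a successor on the spine.\<close>
    have "x \<noteq> Inl v"
    proof
      assume "x = Inl v"
      then have "ps ! i = ps ! k" using leaf_pred[OF vX] e l'(3) k by auto
      then show False using True last i k ps(2) nth_eq_iff_index_eq[of ps i k] by simp
    qed
    then show ?thesis using True x a by auto
  next
    case False
    then have ik: "i = k" using i k last by simp
    obtain y z where yz: "{w. (ps ! i, w) \<in> E} = {y, z}" using succ2[OF i] by blast
    moreover have "l' \<in> {w. (ps ! i, w) \<in> E}" "Inl v \<in> {w. (ps ! i, w) \<in> E}" using l' k ik by auto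
    ultimately have "{w. (ps ! i, w) \<in> E} = {l', Inl v}" using l'(2) by auto
    moreover obtain a where "a \<in> gV H" "l' = Inl a" using l' by (auto simp: X_def)
    ultimately show ?thesis using False l'(2) by auto
  qed
  then obtain xs where xs: "length xs = length ps"
    "\<And>i. i < length ps \<Longrightarrow> xs ! i \<in> gV H \<and> xs ! i \<noteq> v \<and>
      {w. (ps ! i, w) \<in> E} = {Inl (xs ! i), if Suc i < length ps then ps ! Suc i else Inl v}"
    using Skolem_list_nth[of "length ps" "\<lambda>i x. x \<in> gV H \<and> x \<noteq> v \<and>
      {w. (ps ! i, w) \<in> E} = {Inl x, if Suc i < length ps then ps ! Suc i else Inl v}"] by auto
  have xe: "(ps ! i, Inl (xs ! i)) \<in> E" if "i < length ps" for i using xs(2)[OF that] by auto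
  have xX: "Inl (xs ! i) \<in> X" if "i < length ps" for i using xs(2)[OF that] by (simp add: X_def)
  have pred: "(w, Inl (xs ! i)) \<in> E \<longleftrightarrow> w = ps ! i" if "i < length xs" for i w
    using leaf_pred[OF xX[of i]] xe[of i] that xs(1) by auto
  have "distinct xs" unfolding distinct_conv_nth
  proof (intro allI impI)
    fix i j assume ij: "i < length xs" "j < length xs" "i \<noteq> j"
    then have "ps ! i \<noteq> ps ! j" using ps(2) xs(1) nth_eq_iff_index_eq[of ps i j] by simp
    then show "xs ! i \<noteq> xs ! j" using pred[OF ij(1)] pred[OF ij(2)] by metis
  qed
  moreover have "v \<notin> set xs" using xs by (auto simp: in_set_conv_nth)
  ultimately have d: "distinct (xs @ [v])" by simp
  have vV: "v \<in> gV H" using vX by (auto simp: X_def)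
  have gV: "gV H = set (xs @ [v])"
  proof
    show "set (xs @ [v]) \<subseteq> gV H" using xs vV by (auto simp: in_set_conv_nth)
    show "gV H \<subseteq> set (xs @ [v])"
    proof
      fix a assume "a \<in> gV H"
      then have aX: "Inl a \<in> X" by (simp add: X_def)
      then obtain u where u: "(u, Inl a) \<in> E" using leaf_pred by blast
      then have "u \<in> V - X" using EV leaf_out by blast
      then obtain i where i: "i < length ps" "u = ps ! i" using ps(3) by (metis in_set_conv_nth)
      then have "Inl a \<in> {Inl (xs ! i), if Suc i < length ps then ps ! Suc i else Inl v}"
        using u xs(2)[OF i(1)] by blast
      moreover have "Suc i < length ps \<Longrightarrow> Inl a \<noteq> ps ! Suc i" using aX inner[of "Suc i"] by force
      ultimately have "a = xs ! i \<or> a = v" by (auto split: if_splits)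
      then show "a \<in> set (xs @ [v])" using i xs(1) by auto
    qed
  qed
  have vspine: "(ps ! (length xs - 1), Inl v) \<in> E\<^sup>*"
  proof -
    have "k = length xs - 1" using k(1) last xs(1) by simp
    then show ?thesis using l'(3) k(2) by auto
  qed
  have lca: "lca E (Inl ((xs @ [v]) ! i)) (Inl ((xs @ [v]) ! j)) = ps ! i" if "i < j" "j < length (xs @ [v])" for i j
    by (rule lca_on_spine[OF acyc _ pred _ vspine _ d that])
      (use next_edge xX leaf_out xs(1) in auto)
  have alt: "t (ps ! i) = Lab1 \<longleftrightarrow> even i = (t (ps ! 0) = Lab1)" if "i < length ps" for i
    using that
  proof (induction i)
    case (Suc i)
    have m: "ps ! i \<in> V - X" "ps ! Suc i \<in> V - X" using inner Suc.prems by auto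
    then have "t (ps ! i) \<noteq> t (ps ! Suc i)"
      using next_edge[OF Suc.prems] disc unfolding discriminating_def by blast
    moreover have "t (ps ! i) \<noteq> LabOdot" "t (ps ! Suc i) \<noteq> LabOdot" using m lab by auto
    ultimately have "t (ps ! Suc i) = Lab1 \<longleftrightarrow> t (ps ! i) \<noteq> Lab1"
      by (cases "t (ps ! i)"; cases "t (ps ! Suc i)") auto
    then show ?case using Suc by auto
  qed simp
  have "staged (gE H) (\<lambda>i. even i = (t (ps ! 0) = Lab1)) (xs @ [v])"
    unfolding staged_def
  proof (intro allI impI)
    fix i j assume ij: "i < j" "j < length (xs @ [v])"
    have "(xs @ [v]) ! i \<in> gV H" "(xs @ [v]) ! j \<in> gV H" unfolding gV using ij by (intro nth_mem; simp)+
    moreover have "(xs @ [v]) ! i \<noteq> (xs @ [v]) ! j" using d ij nth_eq_iff_index_eq[of "xs @ [v]" i j] by auto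
    ultimately show "((xs @ [v]) ! i, (xs @ [v]) ! j) \<in> gE H \<longleftrightarrow> even i = (t (ps ! 0) = Lab1)"
      using adj lca[OF ij] alt[of i] ij xs(1) by simp
  qed
  then show ?thesis using d gV ps(1) xs(1) by (intro exI[of _ xs] exI[of _ "t (ps ! 0) = Lab1"]) auto
qed

section \<open>Construction of a caterpillar from a list\<close>

lemma measure_acyclic:
  fixes f :: "'v \<Rightarrow> nat"
  assumes "\<And>x y. (x, y) \<in> E \<Longrightarrow> f x < f y" shows "acyclic E"
proof (rule wf_acyclic)
  have "E \<subseteq> measure f" using assms by auto
  then show "wf E" using wf_measure wf_subset by blast
qed

definition alt_label :: "bool \<Rightarrow> nat \<Rightarrow> label" where
  "alt_label b i = (if even i = b then Lab1 else Lab0)"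

lemma alt_label: "alt_label b i = Lab1 \<longleftrightarrow> even i = b" "alt_label b i \<noteq> LabOdot"
  "alt_label b (Suc i) \<noteq> alt_label b i"
  by (auto simp: alt_label_def)

lemma lists_caterpillar:
  assumes H: "is_graph H" and ne: "xs \<noteq> []" and d: "distinct (xs @ [v])" and gV: "gV H = set (xs @ [v])"
    and s: "staged (gE H) (\<lambda>i. even i = b) (xs @ [v])"
  shows "cat_explainable_cherry H v"
proof -
  define n where "n = length xs"
  \<comment> \<open>The last spine vertex gets \<open>v\<close> in place of a next spine vertex, so
    \<open>v\<close> forms a cherry with the last element of \<open>xs\<close>.\<close>
  define nxt where "nxt i = (if Suc i < n then Inr (Suc i) else Inl v :: 'a + nat)" for i
  define E :: "(('a + nat) \<times> ('a + nat)) set" where "E = (\<Union>i<n. {(Inr i, Inl (xs ! i)), (Inr i, nxt i)})"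
  define X :: "('a + nat) set" where "X = Inl ` gV H"
  define V where "V = Inr ` {..<n} \<union> X"
  define t where "t u = (case u of Inl _ \<Rightarrow> LabOdot | Inr i \<Rightarrow> alt_label b i)" for u :: "'a + nat"
  have n0: "0 < n" using ne by (simp add: n_def)
  have xv: "i < n \<Longrightarrow> xs ! i \<noteq> v" for i using d unfolding n_def by (metis disjoint_iff distinct_append list.set_intros(1) nth_mem)
  have xi: "i < n \<Longrightarrow> j < n \<Longrightarrow> xs ! i = xs ! j \<longleftrightarrow> i = j" for i j
    using d by (simp add: n_def nth_eq_iff_index_eq)
  have gV': "gV H = insert v {xs ! i | i. i < n}" unfolding gV n_def by (auto simp: in_set_conv_nth)
  have succ: "(Inr i, w) \<in> E \<longleftrightarrow> i < n \<and> (w = Inl (xs ! i) \<or> w = nxt i)" for i w by (auto simp: E_def)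
  have leaf_out: "(Inl x, w) \<notin> E" for x w by (auto simp: E_def)
  have pred_x: "(w, Inl (xs ! i)) \<in> E \<longleftrightarrow> w = Inr i" if "i < n" for i w
    using that xv xi by (auto simp: E_def nxt_def split: if_splits)
  have pred_v: "(w, Inl v) \<in> E \<longleftrightarrow> w = Inr (n - 1)" for w
    using n0 xv unfolding E_def nxt_def by (auto split: if_splits)
  have pred_0: "(w, Inr 0) \<notin> E" for w by (auto simp: E_def nxt_def split: if_splits)
  have pred_Suc: "(w, Inr (Suc i)) \<in> E \<longleftrightarrow> w = Inr i" if "Suc i < n" for i w
    using that by (auto simp: E_def nxt_def split: if_splits)
  have out: "outdeg E (Inr i) = 2" if "i < n" for i
  proof -
    have "{w. (Inr i, w) \<in> E} = {Inl (xs ! i), nxt i}" using succ that by auto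
    moreover have "Inl (xs ! i) \<noteq> nxt i" using xv[OF that] by (auto simp: nxt_def)
    ultimately show ?thesis by (simp add: outdeg_def)
  qed
  have acyc: "acyclic E"
    by (rule measure_acyclic[where f = "\<lambda>u. case u of Inl _ \<Rightarrow> n | Inr i \<Rightarrow> i"]) (auto simp: E_def nxt_def split: if_splits)
  have ind_Inl: "indeg E (Inl x) = 1" if "x \<in> gV H" for x
    using that gV' pred_x pred_v by (auto simp: indeg_def)
  have ind_0: "indeg E (Inr 0) = 0" using pred_0 by (simp add: indeg_def)
  have ind_Suc: "indeg E (Inr (Suc i)) = 1" if "Suc i < n" for i
    using pred_Suc[OF that] by (simp add: indeg_def)
  have outL: "outdeg E (Inl x) = 0" for x using leaf_out by (simp add: outdeg_def)
  have ind_inner: "indeg E (Inr i) = (if i = 0 then 0 else 1)" if "i < n" for i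
    using ind_0 ind_Suc that by (cases i) auto
  have mem: "u \<in> V \<longleftrightarrow> (\<exists>i<n. u = Inr i) \<or> (\<exists>x\<in>gV H. u = Inl x)" for u by (auto simp: V_def X_def)
  have InrX: "Inr i \<notin> X" for i by (auto simp: X_def)
  have fin: "finite V" using H by (auto simp: V_def X_def is_graph_def)
  have EV: "E \<subseteq> V \<times> V" using gV' by (auto simp: E_def V_def X_def nxt_def split: if_splits)
  have net: "is_network V E X" unfolding is_network_def
  proof (intro conjI disjI2)
    show "\<exists>\<rho>\<in>V. indeg E \<rho> = 0 \<and> 2 \<le> outdeg E \<rho> \<and> (\<forall>u\<in>V. indeg E u = 0 \<longrightarrow> u = \<rho>)"
    proof (intro bexI conjI ballI impI)
      show "Inr 0 \<in> V" using n0 by (simp add: mem)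
      fix u assume "u \<in> V" "indeg E u = 0"
      then show "u = Inr 0" using ind_inner ind_Inl by (auto simp: mem split: if_splits)
    qed (use ind_0 out[OF n0] in auto)
    show "\<forall>x\<in>V. x \<in> X \<longleftrightarrow> outdeg E x = 0 \<and> indeg E x = 1"
      using out outL ind_Inl InrX by (auto simp: mem X_def)
    show "\<forall>u\<in>V. indeg E u \<noteq> 0 \<longrightarrow> u \<notin> X \<longrightarrow>
        indeg E u = 1 \<and> 2 \<le> outdeg E u \<or> indeg E u = 2 \<and> 1 \<le> outdeg E u"
      using ind_inner out by (auto simp: mem X_def split: if_splits)
  qed (use fin EV acyc in \<open>auto simp: V_def\<close>)
  have tree: "is_tree V E X" unfolding is_tree_def using net ind_inner ind_Inl by (auto simp: mem)
  have lab: "labeled_network V E X t" unfolding labeled_network_def using net alt_label(2)[of b]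
    by (auto simp: mem X_def t_def)
  have lca: "lca E (Inl ((xs @ [v]) ! i)) (Inl ((xs @ [v]) ! j)) = Inr i" if "i < j" "j < length (xs @ [v])" for i j
    by (rule lca_on_spine[OF acyc _ _ _ _ _ d that])
      (use succ pred_x leaf_out pred_v in \<open>auto simp: n_def nxt_def\<close>)
  have "sym (gE H)" using H by (simp add: is_graph_def)
  from staged_adjacency[OF this s, of t E Inl]
  have adj: "\<forall>x\<in>gV H. \<forall>y\<in>gV H. x \<noteq> y \<longrightarrow> ((x, y) \<in> gE H \<longleftrightarrow> t (lca E (Inl x) (Inl y)) = Lab1)"
    unfolding gV using lca by (simp add: t_def alt_label(1))
  have ct: "cotree_of H V E t" unfolding cotree_of_def using tree lab adj by (simp add: X_def)
  have disc: "discriminating E X t"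
    unfolding discriminating_def using alt_label(3)[of b] InrX
    by (auto simp: E_def nxt_def t_def X_def gV' split: if_splits) (metis)+
  have cat: "caterpillar V E X" unfolding caterpillar_def
  proof (intro conjI ballI exI)
    let ?ps = "map Inr [0..<n] :: ('a + nat) list"
    show "is_tree V E X" by (fact tree)
    show "outdeg E u = 2" if "u \<in> V - X" for u using that out by (auto simp: mem X_def)
    show "?ps \<noteq> []" using n0 by simp
    show "distinct ?ps" by (simp add: distinct_map)
    show "set ?ps = V - X" by (auto simp: V_def X_def)
    show "indeg E (hd ?ps) = 0" using ind_0 n0 by (simp add: hd_map)
    have tl: "tl ?ps = map Inr [1..<n]" by (simp add: map_tl[symmetric] tl_upt)
    have "E \<inter> ((V - X) \<times> (V - X)) = {(Inr i, Inr (Suc i)) | i. Suc i < n}"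
      using InrX gV' by (auto simp: E_def V_def nxt_def X_def split: if_splits)
    also have "\<dots> = set (zip ?ps (tl ?ps))"
      unfolding tl set_zip by (intro Collect_cong ex_cong1) auto
    finally show "E \<inter> ((V - X) \<times> (V - X)) = set (zip ?ps (tl ?ps))" .
  qed
  have "in_cherry E X (Inl v)" unfolding in_cherry_def
  proof (intro conjI bexI exI)
    show "Inl v \<in> X" "Inl (xs ! (n - 1)) \<in> X" using gV n0 by (auto simp: X_def n_def)
    show "Inl (xs ! (n - 1)) \<noteq> Inl v" "(Inr (n - 1), Inl v) \<in> E" "(Inr (n - 1), Inl (xs ! (n - 1))) \<in> E"
      using xv n0 pred_v pred_x by auto
  qed
  then show ?thesis unfolding cat_explainable_cherry_def using ct disc cat X_def by blast
qed

section \<open>Equivalence of polar-cats and the normal form\<close>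

lemma is_graph_induced: "is_graph G \<Longrightarrow> W \<subseteq> gV G \<Longrightarrow> is_graph (induced G W)"
  by (auto simp: is_graph_def induced_def sym_def irrefl_def intro: finite_subset)

lemma staged_induced: "set zs \<subseteq> W \<Longrightarrow> staged (gE (induced G W)) f zs \<longleftrightarrow> staged (gE G) f zs"
  unfolding staged_def induced_def by (auto simp: subset_iff)

lemma polar_cat_lists:
  assumes G: "is_graph G" and P: "polar_cat_at G v V1 V2"
  shows "\<exists>b xs ys. polar_lists G b v xs ys"
proof -
  have V: "V1 \<subseteq> gV G" "V2 \<subseteq> gV G" "gV G = V1 \<union> V2" "V1 \<inter> V2 = {v}" and c4: "card (gV G) \<ge> 4"
    and c: "cat_explainable_cherry (induced G V1) v" "cat_explainable_cherry (induced G V2) v"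
    using P by (auto simp: polar_cat_at_def pseudo_cograph_def)
  obtain xs b1 where xs: "xs \<noteq> []" "distinct (xs @ [v])" "gV (induced G V1) = set (xs @ [v])"
     "staged (gE (induced G V1)) (\<lambda>i. even i = b1) (xs @ [v])" using caterpillar_lists[OF c(1)] by blast
  obtain ys b2 where ys: "ys \<noteq> []" "distinct (ys @ [v])" "gV (induced G V2) = set (ys @ [v])"
     "staged (gE (induced G V2)) (\<lambda>i. even i = b2) (ys @ [v])" using caterpillar_lists[OF c(2)] by blast
  have V1: "V1 = set (xs @ [v])" and V2: "V2 = set (ys @ [v])" using xs(3) ys(3) by (auto simp: induced_def)
  have b: "connected_graph (induced G V1) \<longleftrightarrow> b1" "connected_graph (induced G V2) \<longleftrightarrow> b2"
    using staged_connected[OF is_graph_induced[OF G V(1)] xs(3,2,1,4)]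
      staged_connected[OF is_graph_induced[OF G V(2)] ys(3,2,1,4)] by auto
  have "v \<notin> set xs" "v \<notin> set ys" "set xs \<inter> set ys = {}" using xs(2) ys(2) V(4) V1 V2 by auto
  then have d: "distinct (v # xs @ ys)" using xs(2) ys(2) by auto
  have gV: "gV G = set (v # xs @ ys)" using V V1 V2 by auto
  have len: "length xs + length ys \<ge> 3" using c4 distinct_card[OF d] unfolding gV by simp
  have del: "gE (delete G v) = gE G \<inter> ((gV G - {v}) \<times> (gV G - {v}))" by (simp add: delete_def induced_def)
  have delV: "gV (delete (induced G V1) v) = set xs" "gV (delete (induced G V2) v) = set ys"
    using \<open>v \<notin> set xs\<close> \<open>v \<notin> set ys\<close> V1 V2 by (auto simp: delete_def induced_def)
  have delE: "gE (delete (induced G V1) v) \<subseteq> set xs \<times> set xs" "gE (delete (induced G V2) v) \<subseteq> set ys \<times> set ys"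
    using V1 V2 by (auto simp: delete_def induced_def)
  have xyG: "(x, y) \<in> gE G \<longleftrightarrow> (x, y) \<in> gE (delete G v)" if "x \<in> set xs" "y \<in> set ys" for x y
    unfolding del gV using d that by auto
  \<comment> \<open>By \<open>staged_connected\<close> both parameters express connectivity, so the
    alternative that holds for the polar-cat makes them equal and decides all edges between the
    lists.\<close>
  have "b1 = b2 \<and> (\<forall>x\<in>set xs. \<forall>y\<in>set ys. (x, y) \<in> gE G \<longleftrightarrow> \<not> b1)"
  proof (cases b1)
    case True
    then have "b2" "disjoint_union_of (delete G v) (delete (induced G V1) v) (delete (induced G V2) v)"
      using P b by (auto simp: polar_cat_at_def)
    then show ?thesis using xyG delE d True by (auto simp: disjoint_union_of_def)
  next
    case False
    then have "\<not> b2" "join_of (delete G v) (delete (induced G V1) v) (delete (induced G V2) v)"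
      using P b by (auto simp: polar_cat_at_def)
    then show ?thesis using xyG delV False by (auto simp: join_of_def)
  qed
  then have "polar_lists G b1 v xs ys" unfolding polar_lists_def
    using xs ys len d gV staged_induced[of "xs @ [v]" V1 G] staged_induced[of "ys @ [v]" V2 G] V1 V2 by auto
  then show ?thesis by blast
qed

lemma polar_lists_cat:
  assumes G: "is_graph G" and P: "polar_lists G b v xs ys"
  shows "polar_cat_at G v (set (xs @ [v])) (set (ys @ [v]))"
proof -
  let ?V1 = "set (xs @ [v])" and ?V2 = "set (ys @ [v])"
  have ne: "xs \<noteq> []" "ys \<noteq> []" and len: "length xs + length ys \<ge> 3"
    and d: "distinct (v # xs @ ys)" and gV: "gV G = set (v # xs @ ys)"
    and s: "staged (gE G) (\<lambda>i. even i = b) (xs @ [v])" "staged (gE G) (\<lambda>i. even i = b) (ys @ [v])"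
    and cr: "\<And>x y. x\<in>set xs \<Longrightarrow> y\<in>set ys \<Longrightarrow> (x, y) \<in> gE G \<longleftrightarrow> \<not> b"
    using P by (auto simp: polar_lists_def)
  have cr': "(y, x) \<in> gE G \<longleftrightarrow> \<not> b" if "x\<in>set xs" "y\<in>set ys" for x y
    using cr[OF that] is_graph_sym[OF G] by blast
  have sub: "?V1 \<subseteq> gV G" "?V2 \<subseteq> gV G" unfolding gV by auto
  have g: "is_graph (induced G ?V1)" "is_graph (induced G ?V2)" using is_graph_induced[OF G] sub by blast+
  have d': "distinct (xs @ [v])" "distinct (ys @ [v])" using d by auto
  have iV: "gV (induced G ?V1) = set (xs @ [v])" "gV (induced G ?V2) = set (ys @ [v])" by (auto simp: induced_def)
  have s': "staged (gE (induced G ?V1)) (\<lambda>i. even i = b) (xs @ [v])" "staged (gE (induced G ?V2)) (\<lambda>i. even i = b) (ys @ [v])"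
    using s staged_induced[OF subset_refl] by blast+
  have con: "connected_graph (induced G ?V1) \<longleftrightarrow> b" "connected_graph (induced G ?V2) \<longleftrightarrow> b"
    using staged_connected[OF g(1) iV(1) d'(1) ne(1) s'(1)] staged_connected[OF g(2) iV(2) d'(2) ne(2) s'(2)] by auto
  have cat: "cat_explainable_cherry (induced G ?V1) v" "cat_explainable_cherry (induced G ?V2) v"
    using lists_caterpillar[OF g(1) ne(1) d'(1) iV(1) s'(1)] lists_caterpillar[OF g(2) ne(2) d'(2) iV(2) s'(2)] by auto
  have dV: "gV (delete G v) = set xs \<union> set ys" "gV (delete (induced G ?V1) v) = set xs"
      "gV (delete (induced G ?V2) v) = set ys"
    using d gV by (auto simp: delete_def induced_def)
  have dE: "gE (delete G v) = gE G \<inter> ((set xs \<union> set ys) \<times> (set xs \<union> set ys))"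
    "gE (delete (induced G ?V1) v) = gE G \<inter> (set xs \<times> set xs)"
    "gE (delete (induced G ?V2) v) = gE G \<inter> (set ys \<times> set ys)"
    using d gV by (auto simp: delete_def induced_def)
  have dis: "set xs \<inter> set ys = {}" using d by auto
  have un: "disjoint_union_of (delete G v) (delete (induced G ?V1) v) (delete (induced G ?V2) v)" if b
    unfolding disjoint_union_of_def dV dE using dis cr cr' that by auto
  have jo: "join_of (delete G v) (delete (induced G ?V1) v) (delete (induced G ?V2) v)" if "\<not> b"
    unfolding join_of_def dV dE using dis cr cr' that by auto
  have "card ?V1 > 1" "card ?V2 > 1" "card (gV G) \<ge> 4"
    using distinct_card[OF d'(1)] distinct_card[OF d'(2)] distinct_card[OF d] ne len unfolding gV by auto
  moreover have "?V1 \<inter> ?V2 = {v}" "gV G = ?V1 \<union> ?V2" "v \<in> gV G" using dis gV by auto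
  ultimately show ?thesis
    unfolding polar_cat_at_def pseudo_cograph_def
    using staged_cograph[OF g(1) iV(1) s'(1)] staged_cograph[OF g(2) iV(2) s'(2)] sub con cat un jo by blast
qed

section \<open>The network of a polar-cat\<close>

text \<open>The network is a single cycle with pendant leaves: spines \<open>p\<close> and
  \<open>q\<close> carry \<open>xs\<close> and \<open>ys\<close>, start at the root \<open>r\<close>
  and end in the hybrid-vertex \<open>h\<close>, whose only child is \<open>v\<close>.\<close>

lemma polar_lists_explainable:
  assumes G: "is_graph G" and P: "polar_lists G b v xs ys"
  shows "level1_explainable G"
proof -
  have ne: "xs \<noteq> []" "ys \<noteq> []" and d: "distinct (v # xs @ ys)" and gV: "gV G = set (v # xs @ ys)"
    and s: "staged (gE G) (\<lambda>i. even i = b) (xs @ [v])" "staged (gE G) (\<lambda>i. even i = b) (ys @ [v])"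
    and cr: "\<And>x y. x\<in>set xs \<Longrightarrow> y\<in>set ys \<Longrightarrow> (x, y) \<in> gE G \<longleftrightarrow> \<not> b"
    using P by (auto simp: polar_lists_def)
  define k m where "k = length xs" and "m = length ys"
  define r h :: "'a + nat" where "r = Inr 0" and "h = Inr 1"
  \<comment> \<open>Parity keeps the spines apart, and the offsets keep them away from
    \<open>r\<close> and \<open>h\<close>.\<close>
  define p q :: "nat \<Rightarrow> 'a + nat" where "p i = Inr (2 * i + 2)" and "q i = Inr (2 * i + 3)" for i
  define np nq where "np i = (if Suc i < k then p (Suc i) else h)" and "nq i = (if Suc i < m then q (Suc i) else h)" for i
  define E where "E = {(r, p 0), (r, q 0), (h, Inl v)} \<union> (\<Union>i<k. {(p i, Inl (xs ! i)), (p i, np i)})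
     \<union> (\<Union>i<m. {(q i, Inl (ys ! i)), (q i, nq i)})"
  define X :: "('a + nat) set" where "X = Inl ` gV G"
  define V where "V = {r, h} \<union> p ` {..<k} \<union> q ` {..<m} \<union> X"
  \<comment> \<open>\<open>(i - 2) div 2\<close> recovers the position on either spine. At
    \<open>h\<close> the subtraction truncates to 0; its label only has to differ from
    \<open>LabOdot\<close>, since \<open>h\<close> has a single leaf below it. The root gets label 1
    exactly if \<open>b\<close> fails, as the edges between the lists require.\<close>
  define t where "t u = (case u of Inl _ \<Rightarrow> LabOdot
      | Inr i \<Rightarrow> if i = 0 then alt_label (\<not> b) 0 else alt_label b ((i - 2) div 2))" for u :: "'a + nat"
  have tr: "t r = alt_label (\<not> b) 0" and tp: "t (p i) = alt_label b i" and tq: "t (q i) = alt_label b i" for i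
  proof -
    have "Suc (2 * i) div 2 = i" by presburger
    then show "t r = alt_label (\<not> b) 0" "t (p i) = alt_label b i" "t (q i) = alt_label b i"
      by (simp_all add: t_def r_def p_def q_def)
  qed
  have k0: "0 < k" "0 < m" using ne by (simp_all add: k_def m_def)
  have inner_simps [simp]: "r \<noteq> h" "h \<noteq> r" "p i \<noteq> r" "r \<noteq> p i" "p i \<noteq> h" "h \<noteq> p i" "q i \<noteq> r" "r \<noteq> q i"
    "q i \<noteq> h" "h \<noteq> q i" "p i = p j \<longleftrightarrow> i = j" "q i = q j \<longleftrightarrow> i = j" "p i \<noteq> q j" "q i \<noteq> p j"
    "Inl x \<noteq> r" "r \<noteq> Inl x" "Inl x \<noteq> h" "h \<noteq> Inl x" "Inl x \<noteq> p i" "p i \<noteq> Inl x" "Inl x \<noteq> q i" "q i \<noteq> Inl x"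
    for i j x
    unfolding r_def h_def p_def q_def by (simp_all, presburger+)
  have xm: "i < k \<Longrightarrow> xs ! i \<in> set xs" and ym: "i < m \<Longrightarrow> ys ! i \<in> set ys" for i by (simp_all add: k_def m_def)
  have xv: "i < k \<Longrightarrow> xs ! i \<noteq> v" and yv: "i < m \<Longrightarrow> ys ! i \<noteq> v" for i
    using d xm ym by auto
  have xy: "i < k \<Longrightarrow> j < m \<Longrightarrow> xs ! i \<noteq> ys ! j" for i j using d xm ym by fastforce
  have xi: "i < k \<Longrightarrow> j < k \<Longrightarrow> xs ! i = xs ! j \<longleftrightarrow> i = j"
    and yi: "i < m \<Longrightarrow> j < m \<Longrightarrow> ys ! i = ys ! j \<longleftrightarrow> i = j" for i j
    using d by (simp_all add: k_def m_def nth_eq_iff_index_eq)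
  note E_simps = E_def np_def nq_def
  have succ_p: "(p i, w) \<in> E \<longleftrightarrow> i < k \<and> (w = Inl (xs ! i) \<or> w = np i)" for i w unfolding E_def by auto
  have succ_q: "(q i, w) \<in> E \<longleftrightarrow> i < m \<and> (w = Inl (ys ! i) \<or> w = nq i)" for i w unfolding E_def by auto
  have succ_r: "(r, w) \<in> E \<longleftrightarrow> w = p 0 \<or> w = q 0" and succ_h: "(h, w) \<in> E \<longleftrightarrow> w = Inl v" for w
    unfolding E_def by auto
  have leaf_out: "(Inl x, w) \<notin> E" for x w unfolding E_def by auto
  have pred_x: "(w, Inl (xs ! i)) \<in> E \<longleftrightarrow> w = p i" if "i < k" for i w
    using that xv xi xy unfolding E_simps by (auto split: if_splits)
  have pred_y: "(w, Inl (ys ! i)) \<in> E \<longleftrightarrow> w = q i" if "i < m" for i w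
    using that yv yi not_sym[OF xy] unfolding E_simps by (auto split: if_splits)
  have pred_v: "(w, Inl v) \<in> E \<longleftrightarrow> w = h" for w
    using xv yv unfolding E_simps by (auto split: if_splits)
  have pred_r: "(w, r) \<notin> E" for w unfolding E_simps by (auto split: if_splits)
  have pred_h: "(w, h) \<in> E \<longleftrightarrow> w = p (k - 1) \<or> w = q (m - 1)" for w
  proof -
    have "(w, h) \<in> E \<longleftrightarrow> (\<exists>i. (i < k \<and> \<not> Suc i < k) \<and> w = p i) \<or> (\<exists>i. (i < m \<and> \<not> Suc i < m) \<and> w = q i)"
      unfolding E_simps by (auto split: if_splits)
    moreover have "i < k \<and> \<not> Suc i < k \<longleftrightarrow> i = k - 1" "i < m \<and> \<not> Suc i < m \<longleftrightarrow> i = m - 1" for i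
      using k0 by auto
    ultimately show ?thesis by simp
  qed
  have pred_p0: "(w, p 0) \<in> E \<longleftrightarrow> w = r" and pred_q0: "(w, q 0) \<in> E \<longleftrightarrow> w = r" for w
    unfolding E_simps by (auto split: if_splits)
  have pred_p: "(w, p (Suc i)) \<in> E \<longleftrightarrow> w = p i" if "Suc i < k" for i w
    using that unfolding E_simps by (auto split: if_splits)
  have pred_q: "(w, q (Suc i)) \<in> E \<longleftrightarrow> w = q i" if "Suc i < m" for i w
    using that unfolding E_simps by (auto split: if_splits)
  have acyc: "acyclic E"
  proof (rule measure_acyclic)
    \<comment> \<open>The numbering is already increasing along the spines; only \<open>h\<close>,
      numbered 1, has to be moved behind both of them, and the leaves behind
      \<open>h\<close>.\<close>
    let ?f = "\<lambda>u. case u of Inl _ \<Rightarrow> 2 * k + 2 * m + 5 | Inr i \<Rightarrow> if i = 1 then 2 * k + 2 * m + 4 else i"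
    show "?f x < ?f y" if "(x, y) \<in> E" for x y
      using that unfolding E_simps r_def h_def p_def q_def by (auto split: if_splits)
  qed
  have gV': "gV G = insert v ({xs ! i | i. i < k} \<union> {ys ! i | i. i < m})"
    unfolding gV k_def m_def by (auto simp: in_set_conv_nth)
  have out_p: "outdeg E (p i) = 2" if "i < k" for i
  proof -
    have "{w. (p i, w) \<in> E} = {Inl (xs ! i), np i}" using succ_p that by auto
    then show ?thesis by (simp add: outdeg_def np_def)
  qed
  have out_q: "outdeg E (q i) = 2" if "i < m" for i
  proof -
    have "{w. (q i, w) \<in> E} = {Inl (ys ! i), nq i}" using succ_q that by auto
    then show ?thesis by (simp add: outdeg_def nq_def)
  qed
  have out_r: "outdeg E r = 2"
  proof -
    have "{w. (r, w) \<in> E} = {p 0, q 0}" using succ_r by auto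
    then show ?thesis by (simp add: outdeg_def)
  qed
  have out_h: "outdeg E h = 1" using succ_h by (simp add: outdeg_def)
  have out_leaf: "outdeg E (Inl x) = 0" for x using leaf_out by (simp add: outdeg_def)
  have in_r: "indeg E r = 0" using pred_r by (simp add: indeg_def)
  have in_h: "indeg E h = 2"
  proof -
    have "{w. (w, h) \<in> E} = {p (k - 1), q (m - 1)}" using pred_h by auto
    then show ?thesis by (simp add: indeg_def)
  qed
  have in_p: "indeg E (p i) = 1" if "i < k" for i
    using that pred_p0 pred_p by (cases i) (auto simp: indeg_def)
  have in_q: "indeg E (q i) = 1" if "i < m" for i
    using that pred_q0 pred_q by (cases i) (auto simp: indeg_def)
  have in_leaf: "indeg E (Inl x) = 1" if "x \<in> gV G" for x
    using that gV' pred_x pred_y pred_v by (auto simp: indeg_def)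
  have mem: "u \<in> V \<longleftrightarrow> u = r \<or> u = h \<or> (\<exists>i<k. u = p i) \<or> (\<exists>i<m. u = q i) \<or> (\<exists>x\<in>gV G. u = Inl x)" for u
    by (auto simp: V_def X_def)
  have memX: "r \<notin> X" "h \<notin> X" "p i \<notin> X" "q i \<notin> X" "Inl x \<in> X \<longleftrightarrow> x \<in> gV G" for i x
    by (auto simp: X_def)
  have fin: "finite V" using G by (auto simp: V_def X_def is_graph_def)
  have VI: "r \<in> V" "h \<in> V" "Inl v \<in> V" "\<And>i. i < k \<Longrightarrow> p i \<in> V" "\<And>i. i < m \<Longrightarrow> q i \<in> V"
    "\<And>i. i < k \<Longrightarrow> Inl (xs ! i) \<in> V" "\<And>i. i < m \<Longrightarrow> Inl (ys ! i) \<in> V"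
    using xm ym by (auto simp: V_def X_def gV)
  moreover have "\<And>i. i < k \<Longrightarrow> np i \<in> V" "\<And>i. i < m \<Longrightarrow> nq i \<in> V"
    using VI by (simp_all add: np_def nq_def)
  ultimately have EV: "E \<subseteq> V \<times> V" unfolding E_def using k0 by auto
  have net: "is_network V E X" unfolding is_network_def
  proof (intro conjI disjI2)
    show "\<exists>\<rho>\<in>V. indeg E \<rho> = 0 \<and> 2 \<le> outdeg E \<rho> \<and> (\<forall>u\<in>V. indeg E u = 0 \<longrightarrow> u = \<rho>)"
    proof (intro bexI conjI ballI impI)
      show "r \<in> V" by (simp add: mem)
      fix u assume "u \<in> V" "indeg E u = 0"
      then show "u = r" using in_h in_p in_q in_leaf by (auto simp: mem)
    qed (use in_r out_r in auto)
    show "\<forall>x\<in>V. x \<in> X \<longleftrightarrow> outdeg E x = 0 \<and> indeg E x = 1"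
      using out_p out_q out_r out_h out_leaf in_leaf memX by (auto simp: mem)
    show "\<forall>u\<in>V. indeg E u \<noteq> 0 \<longrightarrow> u \<notin> X \<longrightarrow>
        indeg E u = 1 \<and> 2 \<le> outdeg E u \<or> indeg E u = 2 \<and> 1 \<le> outdeg E u"
      using in_r in_h in_p in_q out_p out_q out_h memX by (auto simp: mem)
  qed (use fin EV acyc in \<open>auto simp: V_def\<close>)
  \<comment> \<open>There is only one hybrid-vertex in the whole network, so the level-1 condition
    follows without determining any block.\<close>
  have hyb: "u = h" if "u \<in> V" "hybrid E u" for u
    using that in_r in_p in_q in_leaf by (auto simp: mem hybrid_def)
  have lev: "level1_network V E X" unfolding level1_network_def
  proof (intro conjI allI impI net)
    fix W assume "biconnected_component V E W"
    then have "{u\<in>W. hybrid E u} \<subseteq> {h}" using hyb by (auto simp: biconnected_component_def)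
    then have "card {u\<in>W. hybrid E u} \<le> card {h}" by (intro card_mono) auto
    then show "card {u\<in>W. hybrid E u} \<le> 1" by simp
  qed
  have lab: "labeled_network V E X t" unfolding labeled_network_def
  proof (intro conjI ballI)
    have "t h = alt_label b 0" "t (Inl x) = LabOdot" for x by (simp_all add: t_def h_def)
    then show "t u = LabOdot \<longleftrightarrow> u \<in> X" if "u \<in> V" for u
      using that by (auto simp: mem memX tr tp tq alt_label(2) alt_label(2)[symmetric])
  qed (fact net)
  have lca_x: "lca E (Inl ((xs @ [v]) ! i)) (Inl ((xs @ [v]) ! j)) = p i" if "i < j" "j < length (xs @ [v])" for i j
  proof (rule lca_on_spine[OF acyc _ _ _ _ _ _ that])
    have "(p (k - 1), h) \<in> E" "(h, Inl v) \<in> E" using pred_h succ_h by auto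
    then show "(p (length xs - 1), Inl v) \<in> E\<^sup>*" unfolding k_def by auto
  qed (use succ_p pred_x leaf_out d in \<open>auto simp: k_def np_def\<close>)
  have lca_y: "lca E (Inl ((ys @ [v]) ! i)) (Inl ((ys @ [v]) ! j)) = q i" if "i < j" "j < length (ys @ [v])" for i j
  proof (rule lca_on_spine[OF acyc _ _ _ _ _ _ that])
    have "(q (m - 1), h) \<in> E" "(h, Inl v) \<in> E" using pred_h succ_h by auto
    then show "(q (length ys - 1), Inl v) \<in> E\<^sup>*" unfolding m_def by auto
  qed (use succ_q pred_y leaf_out d in \<open>auto simp: m_def nq_def\<close>)
  have anc_r: "w = r" if "(w, r) \<in> E\<^sup>*" for w
    using that by (cases rule: rtranclE) (use pred_r in auto)
  \<comment> \<open>Ancestors of a spine vertex stay on its spine or are the root; with the same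
    fact for \<open>q\<close>, leaves on different sides have only \<open>r\<close> in
    common.\<close>
  have anc_p: "w \<in> insert r (range p)" if "(w, p i) \<in> E\<^sup>*" "i < k" for w i
    using that
  proof (induction i)
    case 0
    from "0.prems"(1) show ?case by (cases rule: rtranclE) (use anc_r pred_p0 in auto)
  next
    case (Suc i)
    from Suc.prems(1) show ?case
      by (cases rule: rtranclE) (use Suc pred_p[of i] in auto)
  qed
  have anc_q: "w \<in> insert r (range q)" if "(w, q i) \<in> E\<^sup>*" "i < m" for w i
    using that
  proof (induction i)
    case 0
    from "0.prems"(1) show ?case by (cases rule: rtranclE) (use anc_r pred_q0 in auto)
  next
    case (Suc i)
    from Suc.prems(1) show ?case
      by (cases rule: rtranclE) (use Suc pred_q[of i] in auto)
  qed
  have lca_xy: "lca E (Inl (xs ! i)) (Inl (ys ! j)) = r" if ij: "i < k" "j < m" for i j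
  proof (rule lca_eqI[OF acyc])
    have "(p 0, p i) \<in> E\<^sup>*" by (rule chain_reaches[of k]) (use ij succ_p in \<open>auto simp: np_def\<close>)
    then show "(r, Inl (xs ! i)) \<in> E\<^sup>*"
      using succ_r[of "p 0"] pred_x[OF ij(1), of "p i"]
      by (meson converse_rtrancl_into_rtrancl rtrancl.rtrancl_into_rtrancl)
    have "(q 0, q j) \<in> E\<^sup>*" by (rule chain_reaches[of m]) (use ij succ_q in \<open>auto simp: nq_def\<close>)
    then show "(r, Inl (ys ! j)) \<in> E\<^sup>*"
      using succ_r[of "q 0"] pred_y[OF ij(2), of "q j"]
      by (meson converse_rtrancl_into_rtrancl rtrancl.rtrancl_into_rtrancl)
    fix w assume w: "(w, Inl (xs ! i)) \<in> E\<^sup>*" "(w, Inl (ys ! j)) \<in> E\<^sup>*"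
    have "w = Inl (xs ! i) \<or> (w, p i) \<in> E\<^sup>*" using w(1) pred_x[OF ij(1)] by (auto elim: rtranclE)
    moreover have "w = Inl (ys ! j) \<or> (w, q j) \<in> E\<^sup>*" using w(2) pred_y[OF ij(2)] by (auto elim: rtranclE)
    ultimately have "w = r" using anc_p[of w i] anc_q[of w j] ij xy by auto
    then show "(w, r) \<in> E\<^sup>*" by simp
  qed
  have sym: "sym (gE G)" using G by (simp add: is_graph_def)
  have adj_x: "(x, y) \<in> gE G \<longleftrightarrow> t (lca E (Inl x) (Inl y)) = Lab1"
    if "x \<in> set (xs @ [v])" "y \<in> set (xs @ [v])" "x \<noteq> y" for x y
    by (rule staged_adjacency[OF sym s(1) _ that]) (use lca_x tp alt_label(1) in auto)
  have adj_y: "(x, y) \<in> gE G \<longleftrightarrow> t (lca E (Inl x) (Inl y)) = Lab1"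
    if "x \<in> set (ys @ [v])" "y \<in> set (ys @ [v])" "x \<noteq> y" for x y
    by (rule staged_adjacency[OF sym s(2) _ that]) (use lca_y tq alt_label(1) in auto)
  have adj_xy: "(x, y) \<in> gE G \<longleftrightarrow> t (lca E (Inl x) (Inl y)) = Lab1" if mem_xy: "x \<in> set xs" "y \<in> set ys" for x y
  proof -
    obtain i j where "i < k" "x = xs ! i" "j < m" "y = ys ! j" using mem_xy by (auto simp: in_set_conv_nth k_def m_def)
    then show ?thesis using lca_xy cr[OF mem_xy] tr alt_label(1)[of "\<not> b" 0] by simp
  qed
  have adj_yx: "(y, x) \<in> gE G \<longleftrightarrow> t (lca E (Inl y) (Inl x)) = Lab1" if "x \<in> set xs" "y \<in> set ys" for x y
    using adj_xy[OF that] is_graph_sym[OF G, of x y] lca_commute[of E "Inl x"] by simp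
  have "(x, y) \<in> gE G \<longleftrightarrow> t (lca E (Inl x) (Inl y)) = Lab1" if mem_xy: "x \<in> gV G" "y \<in> gV G" "x \<noteq> y" for x y
  proof -
    have "x \<in> set (v # xs @ ys)" "y \<in> set (v # xs @ ys)" using mem_xy gV by blast+
    then consider "x \<in> set (xs @ [v])" "y \<in> set (xs @ [v])" | "x \<in> set (ys @ [v])" "y \<in> set (ys @ [v])"
      | "x \<in> set xs" "y \<in> set ys" | "y \<in> set xs" "x \<in> set ys" by auto
    then show ?thesis
    proof cases
      case 1 then show ?thesis using adj_x mem_xy(3) by blast
    next
      case 2 then show ?thesis using adj_y mem_xy(3) by blast
    next
      case 3 then show ?thesis using adj_xy by blast
    next
      case 4 then show ?thesis using adj_yx by blast
    qed
  qed
  then have "explains_via E X t projl G" unfolding explains_via_def X_def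
    by (auto simp: bij_betw_def inj_on_def image_image)
  then show ?thesis unfolding level1_explainable_def using lev lab by blast
qed

theorem mainTheorem3:
  fixes G :: "'a graph"
  assumes "is_graph G"
  shows "polar_cat G \<longleftrightarrow> primitive G \<and> level1_explainable G"
proof
  assume "polar_cat G"
  then obtain b v xs ys where "polar_lists G b v xs ys"
    using polar_cat_lists[OF assms] unfolding polar_cat_def by blast
  then show "primitive G \<and> level1_explainable G"
    using polar_lists_primitive[OF assms] polar_lists_explainable[OF assms] by blast
next
  assume "primitive G \<and> level1_explainable G"
  then show "polar_cat G"
    using explainable_polar_lists[OF assms] polar_lists_cat[OF assms] unfolding polar_cat_def by blast
qed

end
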